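(* Let $I\in\mathbb S$. One has the (orthogonal) Hilbertian decomposition $$L^2(\mathbb C_I;e^{-|q|^2}d\lambda_I)=\bigoplus_{k=0}^{+\infty}\mathcal{SR}^2_{2,k},$$ where each function in $\mathcal{SR}^2_{2,k}$ is identified with its restriction to $\mathbb C_I$.
   Context: $\mathbb H$ is the algebra of quaternions, $\mathbb S=\{I\in\mathbb H: I^2=-1\}$, $\mathbb C_I=\mathbb R+\mathbb R I$, and $d\lambda_I$ is Lebesgue measure on $\mathbb C_I\cong\mathbb R^2$. $L^2(\mathbb C_I;e^{-|q|^2}d\lambda_I)$ is the right quaternionic Hilbert space of $\mathbb H$-valued square integrable functions on $\mathbb C_I$ with inner product $\langle f,g\rangle_{\mathbb C_I}=\int_{\mathbb C_I}\overline{f(q)}\,g(q)\,e^{-|q|^2}d\lambda_I(q)$. Quaternionic Hermite polynomials: $H^Q_{m,n}(q,\overline q)=m!n!\sum_{j=0}^{\min(m,n)}\frac{(-1)^j}{j!}\frac{q^{m-j}\overline q^{\,n-j}}{(m-j)!(n-j)!}$. $\mathcal{SR}^2_{2,k}=\Big\{\sum_{j=0}^{\infty}H^Q_{j,k}(q,\overline q)c_j:\ c_j\in\mathbb H,\ \sum_{j=0}^\infty j!|c_j|^2<\infty\Big\}$, a space of functions on $\mathbb H$. *)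

theory Defs
  imports "HOL-Analysis.Analysis"
begin

section \<open>The algebra of quaternions\<close>

datatype quat = Quat (q1: real) (qi: real) (qj: real) (qk: real)

lemma quat_eqI: "q1 x = q1 y \<Longrightarrow> qi x = qi y \<Longrightarrow> qj x = qj y \<Longrightarrow> qk x = qk y \<Longrightarrow> x = y"
  by (cases x; cases y) simp

lemma quat_eq_iff: "x = y \<longleftrightarrow> q1 x = q1 y \<and> qi x = qi y \<and> qj x = qj y \<and> qk x = qk y"
  by (auto intro: quat_eqI)

instantiation quat :: ring_1
begin

definition "0 = Quat 0 0 0 0"
definition "1 = Quat 1 0 0 0"
definition "x + y = Quat (q1 x + q1 y) (qi x + qi y) (qj x + qj y) (qk x + qk y)"
definition "x - y = Quat (q1 x - q1 y) (qi x - qi y) (qj x - qj y) (qk x - qk y)"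
definition "- x = Quat (- q1 x) (- qi x) (- qj x) (- qk x)"
definition "x * y = Quat
  (q1 x * q1 y - qi x * qi y - qj x * qj y - qk x * qk y)
  (q1 x * qi y + qi x * q1 y + qj x * qk y - qk x * qj y)
  (q1 x * qj y - qi x * qk y + qj x * q1 y + qk x * qi y)
  (q1 x * qk y + qi x * qj y - qj x * qi y + qk x * q1 y)"

instance
  by standard
     (simp_all add: zero_quat_def one_quat_def plus_quat_def minus_quat_def uminus_quat_def
        times_quat_def algebra_simps)

end

lemma quat_sel_simps [simp]:
  "q1 0 = 0" "qi 0 = 0" "qj 0 = 0" "qk 0 = 0"
  "q1 1 = 1" "qi 1 = 0" "qj 1 = 0" "qk 1 = 0"
  "q1 (x + y) = q1 x + q1 y" "qi (x + y) = qi x + qi y"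
  "qj (x + y) = qj x + qj y" "qk (x + y) = qk x + qk y"
  "q1 (x - y) = q1 x - q1 y" "qi (x - y) = qi x - qi y"
  "qj (x - y) = qj x - qj y" "qk (x - y) = qk x - qk y"
  "q1 (- x) = - q1 x" "qi (- x) = - qi x" "qj (- x) = - qj x" "qk (- x) = - qk x"
  by (simp_all add: zero_quat_def one_quat_def plus_quat_def minus_quat_def uminus_quat_def)

lemma quat_times_sel:
  "q1 (x * y) = q1 x * q1 y - qi x * qi y - qj x * qj y - qk x * qk y"
  "qi (x * y) = q1 x * qi y + qi x * q1 y + qj x * qk y - qk x * qj y"
  "qj (x * y) = q1 x * qj y - qi x * qk y + qj x * q1 y + qk x * qi y"
  "qk (x * y) = q1 x * qk y + qi x * qj y - qj x * qi y + qk x * q1 y"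
  by (simp_all add: times_quat_def)

instantiation quat :: real_algebra_1
begin

definition "r *\<^sub>R x = Quat (r * q1 x) (r * qi x) (r * qj x) (r * qk x)"

instance
  by standard (auto simp: quat_eq_iff scaleR_quat_def quat_times_sel algebra_simps)

end

lemma quat_scaleR_sel [simp]:
  "q1 (r *\<^sub>R x) = r * q1 x" "qi (r *\<^sub>R x) = r * qi x"
  "qj (r *\<^sub>R x) = r * qj x" "qk (r *\<^sub>R x) = r * qk x"
  by (simp_all add: scaleR_quat_def)

text \<open>Unqualified \<^const>\<open>inner\<close> on \<^typ>\<open>quat\<close> is the real Euclidean inner product of \<open>\<real>\<^sup>4\<close>.\<close>

instantiation quat :: real_inner
begin

definition "inner x y = q1 x * q1 y + qi x * qi y + qj x * qj y + qk x * qk y"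
definition "norm (x::quat) = sqrt ((q1 x)\<^sup>2 + (qi x)\<^sup>2 + (qj x)\<^sup>2 + (qk x)\<^sup>2)"
definition "sgn (x::quat) = x /\<^sub>R norm x"
definition "dist (x::quat) y = norm (x - y)"
definition [code del]:
  "(uniformity :: (quat \<times> quat) filter) = (INF e\<in>{0 <..}. principal {(x, y). dist x y < e})"
definition [code del]:
  "open (U :: quat set) \<longleftrightarrow> (\<forall>x\<in>U. eventually (\<lambda>(x', y). x' = x \<longrightarrow> y \<in> U) uniformity)"

instance
proof
  fix x :: quat
  have "(0::real) \<le> (q1 x)\<^sup>2 + (qi x)\<^sup>2 + (qj x)\<^sup>2 + (qk x)\<^sup>2" by simp
  then show "0 \<le> inner x x" by (simp add: inner_quat_def power2_eq_square)
  show "inner x x = 0 \<longleftrightarrow> x = 0"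
    by (simp add: inner_quat_def quat_eq_iff add_nonneg_eq_0_iff)
  show "norm x = sqrt (inner x x)"
    by (simp add: inner_quat_def norm_quat_def power2_eq_square)
qed (rule sgn_quat_def dist_quat_def uniformity_quat_def open_quat_def |
     simp add: inner_quat_def algebra_simps)+

end

instance quat :: real_normed_algebra_1
proof
  fix x y :: quat
  have "norm (x * y) = norm x * norm y"
    unfolding norm_quat_def real_sqrt_mult[symmetric] quat_times_sel
    by (rule arg_cong[where f = sqrt]) algebra
  then show "norm (x * y) \<le> norm x * norm y" by simp
qed (simp add: norm_quat_def)

instantiation quat :: euclidean_space
begin

definition "Basis = {Quat 1 0 0 0, Quat 0 1 0 0, Quat 0 0 1 0, Quat 0 0 0 1}"

instance
proof
  fix x :: quat
  show "(\<forall>u\<in>Basis. inner x u = 0) \<longleftrightarrow> x = 0"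
    unfolding quat_eq_iff[of x 0] by (simp add: Basis_quat_def inner_quat_def)
qed (auto simp: Basis_quat_def inner_quat_def)

end

definition qcnj :: "quat \<Rightarrow> quat"
  where "qcnj x = Quat (q1 x) (- qi x) (- qj x) (- qk x)"


section \<open>Slices and their \<open>L\<^sup>2\<close> spaces\<close>

definition imag_units :: "quat set"
  where "imag_units = {I. I\<^sup>2 = - 1}"

definition slice :: "quat \<Rightarrow> quat set"
  where "slice I = range (\<lambda>(x, y). of_real x + of_real y * I)"

definition slice_lebesgue :: "quat \<Rightarrow> quat measure"
  where "slice_lebesgue I = completion
    (distr (lborel :: (real \<times> real) measure) (restrict_space borel (slice I))
      (\<lambda>(x, y). of_real x + of_real y * I))"

text \<open>
  Since \<open>space (slice_lebesgue I) = slice I\<close>, all notions below only see the restriction to the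
  slice of a function defined on the whole of \<^typ>\<open>quat\<close>. Elements of \<open>L\<^sup>2\<close> are
  represented by functions; equality in \<open>L\<^sup>2\<close> is equality almost everywhere on the slice.
\<close>

definition L2 :: "quat \<Rightarrow> (quat \<Rightarrow> quat) set"
  where "L2 I = {f \<in> borel_measurable (slice_lebesgue I).
    integrable (slice_lebesgue I) (\<lambda>q. (norm (f q))\<^sup>2 * exp (- (norm q)\<^sup>2))}"

definition L2_inner :: "quat \<Rightarrow> (quat \<Rightarrow> quat) \<Rightarrow> (quat \<Rightarrow> quat) \<Rightarrow> quat"
  where "L2_inner I f g = (\<integral>q. exp (- (norm q)\<^sup>2) *\<^sub>R (qcnj (f q) * g q) \<partial>slice_lebesgue I)"

definition L2_norm :: "quat \<Rightarrow> (quat \<Rightarrow> quat) \<Rightarrow> real"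
  where "L2_norm I f = sqrt (\<integral>q. (norm (f q))\<^sup>2 * exp (- (norm q)\<^sup>2) \<partial>slice_lebesgue I)"

definition closed_right_subspace :: "quat \<Rightarrow> (quat \<Rightarrow> quat) set \<Rightarrow> bool"
  where "closed_right_subspace I V \<longleftrightarrow>
    V \<subseteq> L2 I \<and>
    (\<lambda>q. 0) \<in> V \<and>
    (\<forall>f\<in>V. \<forall>g\<in>V. (\<lambda>q. f q + g q) \<in> V) \<and>
    (\<forall>f\<in>V. \<forall>c. (\<lambda>q. f q * c) \<in> V) \<and>
    (\<forall>u f. (\<forall>n. u n \<in> V) \<and> f \<in> L2 I \<and> (\<lambda>n. L2_norm I (\<lambda>q. u n q - f q)) \<longlonglongrightarrow> 0
       \<longrightarrow> (\<exists>g\<in>V. AE q in slice_lebesgue I. f q = g q))"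

text \<open>The sums in \<open>L\<^sup>2\<close> of the convergent series with \<open>k\<close>-th term in \<open>V k\<close>.\<close>

definition hilbert_sum :: "quat \<Rightarrow> (nat \<Rightarrow> (quat \<Rightarrow> quat) set) \<Rightarrow> (quat \<Rightarrow> quat) set"
  where "hilbert_sum I V = {f \<in> L2 I. \<exists>u. (\<forall>k. u k \<in> V k) \<and>
    (\<lambda>n. L2_norm I (\<lambda>q. f q - (\<Sum>k<n. u k q))) \<longlonglongrightarrow> 0}"

definition orthogonal_hilbert_decomposition ::
    "quat \<Rightarrow> (quat \<Rightarrow> quat) set \<Rightarrow> (nat \<Rightarrow> (quat \<Rightarrow> quat) set) \<Rightarrow> bool"
  where "orthogonal_hilbert_decomposition I H V \<longleftrightarrow>
    (\<forall>k. closed_right_subspace I (V k)) \<and>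
    (\<forall>k l. k \<noteq> l \<longrightarrow> (\<forall>f\<in>V k. \<forall>g\<in>V l. L2_inner I f g = 0)) \<and>
    H = hilbert_sum I V"


section \<open>Quaternionic Hermite polynomials and the spaces they span\<close>

definition HQ :: "nat \<Rightarrow> nat \<Rightarrow> quat \<Rightarrow> quat"
  where "HQ m n q = (fact m * fact n) *\<^sub>R
    (\<Sum>j\<le>min m n. ((- 1) ^ j / fact j) *\<^sub>R
      ((q ^ (m - j) * qcnj q ^ (n - j)) /\<^sub>R (fact (m - j) * fact (n - j))))"

definition SR2 :: "nat \<Rightarrow> (quat \<Rightarrow> quat) set"
  where "SR2 k = {F. \<exists>c. summable (\<lambda>j. fact j * (norm (c j :: quat))\<^sup>2) \<and>
    (\<forall>q. (\<lambda>j. HQ j k q * c j) sums F q)}"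

end

theory Submission
  imports Defs "HOL-Probability.Probability"
begin

text \<open>
  On the slice, identified with the complex plane, the Hermite polynomials \<open>H\<^sub>m\<^sub>,\<^sub>n\<close> are orthogonal with
  squared norm \<open>\<pi> m! n!\<close>: Gaussian integration by parts gives the integrals of \<open>z ^ a * cnj z ^ b\<close>, and the recurrence
  \<open>H\<^sub>m\<^sub>+\<^sub>1\<^sub>,\<^sub>n = z H\<^sub>m\<^sub>,\<^sub>n - n H\<^sub>m\<^sub>,\<^sub>n\<^sub>-\<^sub>1\<close> evaluates the integrals of monomials against \<open>H\<^sub>m\<^sub>,\<^sub>n\<close>.
  They are total because a function orthogonal to all of them has vanishing moments after
  multiplication by the Gaussian weight; its Fourier transform then vanishes, and Levy's uniqueness
  theorem, applied in one variable at a time, shows that it is zero almost everywhere.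
  Bessel's inequality identifies the elements of \<open>SR2 k\<close> with their \<open>L\<^sup>2\<close> coefficients, which yields
  closedness, and the Riesz--Fischer theorem makes the expansion of an arbitrary function converge.
\<close>

text \<open>\<open>L2 I\<close> lives on the completed slice measure, while transport along the
  embedding of the complex plane handles Borel functions; totality is therefore proved for a Borel
  representative and carried back. The weight is moved into the measure, which makes the measure
  finite, and finiteness is what lets square integrability control absolute convergence.
  Noncommutativity does little harm because the \<open>HQ\<close> have real coefficients: on the
  slice they take values in a commutative copy of the complex numbers, and the quaternionic
  coefficients stay on the right, where \<open>qip\<close> is linear. A quaternion-valued function
  is handled through its four real coordinates, tested against real monomials. A function in
  \<open>SR2 k\<close> is a pointwise sum on all quaternions, whereas the decomposition sees only
  one slice. The factorial weight on the coefficients beats the geometric growth of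
  \<open>HQ j k q\<close> in j, which gives convergence everywhere; coefficients computed on the
  slice then determine the function off it.\<close>

section \<open>Quaternions\<close>

text \<open>Euler's four-square identity. The type class of normed algebras records only the
  inequality, while the exact form is needed to split squared norms of products.\<close>

lemma norm_mult_quat: "norm (x * y) = norm x * norm (y::quat)"
  unfolding norm_quat_def real_sqrt_mult[symmetric] quat_times_sel
  by (rule arg_cong[where f = sqrt]) algebra

lemma norm_power_quat: "norm (x ^ n) = norm (x::quat) ^ n"
  by (induction n) (simp_all add: norm_mult_quat)

lemma quat_of_real_sel [simp]:
  "q1 (of_real r) = r" "qi (of_real r) = 0" "qj (of_real r) = 0" "qk (of_real r) = 0"
  by (simp_all add: of_real_def)

lemma qcnj_sel [simp]:
  "q1 (qcnj x) = q1 x" "qi (qcnj x) = - qi x" "qj (qcnj x) = - qj x" "qk (qcnj x) = - qk x"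
  by (simp_all add: qcnj_def)

lemma qcnj_simps [simp]:
  "qcnj 0 = 0" "qcnj 1 = 1" "qcnj (x + y) = qcnj x + qcnj y" "qcnj (x - y) = qcnj x - qcnj y"
  "qcnj (r *\<^sub>R x) = r *\<^sub>R qcnj x" "qcnj (of_real r) = of_real r" "qcnj (qcnj x) = x"
  by (simp_all add: quat_eq_iff)

lemma qcnj_mult: "qcnj (x * y) = qcnj y * qcnj x"
  by (simp add: quat_eq_iff quat_times_sel algebra_simps)

lemma qcnj_sum: "qcnj (\<Sum>i\<in>A. f i) = (\<Sum>i\<in>A. qcnj (f i))"
  by (induction A rule: infinite_finite_induct) simp_all

lemma norm_qcnj [simp]: "norm (qcnj x) = norm x"
  by (simp add: norm_quat_def)

lemma qcnj_mult_self: "qcnj x * x = of_real ((norm x)\<^sup>2)"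
  by (simp add: quat_eq_iff quat_times_sel norm_quat_def power2_eq_square)

lemma bounded_linear_qcnj: "bounded_linear qcnj"
  by (rule bounded_linear_intro[where K = 1]) simp_all

lemma bounded_linear_q_sel:
  "bounded_linear q1" "bounded_linear qi" "bounded_linear qj" "bounded_linear qk"
  by (rule bounded_linear_intro[where K = 1]; simp add: norm_quat_def real_le_rsqrt)+

lemmas [measurable] =
  borel_measurable_continuous_onI[OF linear_continuous_on[OF bounded_linear_qcnj]]
  bounded_linear_q_sel[THEN linear_continuous_on, THEN borel_measurable_continuous_onI]

lemma norm_sq_quat: "(norm x)\<^sup>2 = (q1 x)\<^sup>2 + (qi x)\<^sup>2 + (qj x)\<^sup>2 + (qk x)\<^sup>2"
  by (simp add: norm_quat_def)

text \<open>Polarisation: \<open>q1 (qcnj y * x)\<close> is the Euclidean inner product of x and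
  y.\<close>

lemma norm_diff_sq_quat: "(norm (x - y))\<^sup>2 = (norm x)\<^sup>2 + (norm y)\<^sup>2 - 2 * q1 (qcnj y * x)" for x y :: quat
  unfolding norm_sq_quat by (simp add: quat_times_sel power2_eq_square algebra_simps)

section \<open>Square integrable quaternion-valued functions\<close>

text \<open>The Gaussian weight is left to the measure: \<open>L2 I\<close> turns out to be
  \<open>sqint (slice_gauss I)\<close>, and the same theory also serves \<open>cgauss\<close> on the
  complex plane.\<close>

definition sqint :: "'a measure \<Rightarrow> ('a \<Rightarrow> quat) set"
  where "sqint M = {f \<in> borel_measurable M. integrable M (\<lambda>x. (norm (f x))\<^sup>2)}"

definition qip :: "'a measure \<Rightarrow> ('a \<Rightarrow> quat) \<Rightarrow> ('a \<Rightarrow> quat) \<Rightarrow> quat"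
  where "qip M f g = (\<integral>x. qcnj (f x) * g x \<partial>M)"

text \<open>Working with the squared norm keeps Pythagoras, Bessel and Fatou free of square roots;
  \<open>L2_norm_tendsto_iff\<close> translates back.\<close>

definition qn2 :: "'a measure \<Rightarrow> ('a \<Rightarrow> quat) \<Rightarrow> real"
  where "qn2 M f = (\<integral>x. (norm (f x))\<^sup>2 \<partial>M)"

lemma sqint_measurable: "f \<in> sqint M \<Longrightarrow> f \<in> borel_measurable M"
  and sqint_integrable: "f \<in> sqint M \<Longrightarrow> integrable M (\<lambda>x. (norm (f x))\<^sup>2)"
  by (auto simp: sqint_def)

lemma norm_add_sq_le: "(norm (x + y))\<^sup>2 \<le> 2 * (norm x)\<^sup>2 + 2 * (norm y)\<^sup>2" for x y :: "'a::real_normed_vector"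
proof -
  have "(norm (x + y))\<^sup>2 \<le> (norm x + norm y)\<^sup>2"
    by (intro power_mono norm_triangle_ineq) simp
  also have "\<dots> \<le> 2 * (norm x)\<^sup>2 + 2 * (norm y)\<^sup>2"
    using sum_squares_ge_zero[of "norm x - norm y" 0] by (simp add: power2_eq_square algebra_simps)
  finally show ?thesis .
qed

lemma sqint_zero [simp]: "(\<lambda>x. 0) \<in> sqint M"
  by (simp add: sqint_def)

lemma sqint_add:
  assumes "f \<in> sqint M" "g \<in> sqint M"
  shows "(\<lambda>x. f x + g x) \<in> sqint M"
proof -
  note [measurable] = assms[THEN sqint_measurable]
  have "integrable M (\<lambda>x. 2 * (norm (f x))\<^sup>2 + 2 * (norm (g x))\<^sup>2)"
    using assms by (auto simp: sqint_def)
  then have "integrable M (\<lambda>x. (norm (f x + g x))\<^sup>2)"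
    by (rule Bochner_Integration.integrable_bound) (auto simp: norm_add_sq_le)
  then show ?thesis by (simp add: sqint_def)
qed

lemma sqint_mult_right: "f \<in> sqint M \<Longrightarrow> (\<lambda>x. f x * c) \<in> sqint M"
  by (auto simp: sqint_def norm_mult_quat power_mult_distrib)

lemma sqint_diff: "f \<in> sqint M \<Longrightarrow> g \<in> sqint M \<Longrightarrow> (\<lambda>x. f x - g x) \<in> sqint M"
  using sqint_add[of f M "\<lambda>x. g x * - 1"] sqint_mult_right[of g M "- 1"] by simp

lemma sqint_sum: "(\<And>i. i \<in> A \<Longrightarrow> f i \<in> sqint M) \<Longrightarrow> (\<lambda>x. \<Sum>i\<in>A. f i x) \<in> sqint M"
  by (induction A rule: infinite_finite_induct) (auto intro: sqint_add)

lemma sqint_cong_AE: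
  assumes "f \<in> sqint M" "g \<in> borel_measurable M" "AE x in M. f x = g x"
  shows "g \<in> sqint M"
proof -
  note [measurable] = assms(2) assms(1)[THEN sqint_measurable]
  have "integrable M (\<lambda>x. (norm (g x))\<^sup>2) = integrable M (\<lambda>x. (norm (f x))\<^sup>2)"
    by (rule integrable_cong_AE) (use assms(3) in auto)
  with assms show ?thesis by (auto simp: sqint_def)
qed

lemma two_mult_le_sq: "2 * (a * b) \<le> a\<^sup>2 + b\<^sup>2" for a b :: real
  using zero_le_power2[of "a - b"] by (simp add: power2_eq_square algebra_simps)

lemma sqint_integrable_mult_norm:
  assumes "f \<in> sqint M" "g \<in> sqint M"
  shows "integrable M (\<lambda>x. norm (f x) * norm (g x))"
proof -
  note [measurable] = assms[THEN sqint_measurable]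
  have "integrable M (\<lambda>x. (norm (f x))\<^sup>2 + (norm (g x))\<^sup>2)"
    using assms by (auto simp: sqint_def)
  then show ?thesis
  proof (rule Bochner_Integration.integrable_bound)
    show "AE x in M. norm (norm (f x) * norm (g x)) \<le> norm ((norm (f x))\<^sup>2 + (norm (g x))\<^sup>2)"
    proof (rule AE_I2)
      fix x
      show "norm (norm (f x) * norm (g x)) \<le> norm ((norm (f x))\<^sup>2 + (norm (g x))\<^sup>2)"
        using two_mult_le_sq[of "norm (f x)" "norm (g x)"]
          mult_nonneg_nonneg[of "norm (f x)" "norm (g x)"]
        by (simp del: mult_nonneg_nonneg zero_le_mult_iff)
    qed
  qed measurable
qed

lemma qip_integrable:
  assumes "f \<in> sqint M" "g \<in> sqint M"
  shows "integrable M (\<lambda>x. qcnj (f x) * g x)"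
proof -
  note [measurable] = assms[THEN sqint_measurable]
  show ?thesis
    by (rule Bochner_Integration.integrable_bound[OF sqint_integrable_mult_norm[OF assms]])
       (auto simp: norm_mult_quat)
qed

lemma qip_add_right:
  "f \<in> sqint M \<Longrightarrow> g \<in> sqint M \<Longrightarrow> h \<in> sqint M \<Longrightarrow>
    qip M f (\<lambda>x. g x + h x) = qip M f g + qip M f h"
  by (simp add: qip_def distrib_left qip_integrable)

lemma qip_diff_right:
  "f \<in> sqint M \<Longrightarrow> g \<in> sqint M \<Longrightarrow> h \<in> sqint M \<Longrightarrow>
    qip M f (\<lambda>x. g x - h x) = qip M f g - qip M f h"
  by (simp add: qip_def right_diff_distrib qip_integrable)

lemma qip_mult_right:
  assumes "f \<in> sqint M" "g \<in> sqint M"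
  shows "qip M f (\<lambda>x. g x * c) = qip M f g * c"
  unfolding qip_def mult.assoc[symmetric]
  by (rule integral_bounded_linear[OF bounded_linear_mult_left qip_integrable[OF assms]])

lemma qip_sum_right:
  "f \<in> sqint M \<Longrightarrow> (\<And>i. i \<in> A \<Longrightarrow> g i \<in> sqint M) \<Longrightarrow>
    qip M f (\<lambda>x. \<Sum>i\<in>A. g i x) = (\<Sum>i\<in>A. qip M f (g i))"
  by (simp add: qip_def sum_distrib_left qip_integrable)

lemma qip_commute:
  assumes "f \<in> sqint M" "g \<in> sqint M"
  shows "qip M g f = qcnj (qip M f g)"
  unfolding qip_def
  by (subst integral_bounded_linear[OF bounded_linear_qcnj qip_integrable[OF assms], symmetric])
     (simp add: qcnj_mult)

lemma qip_self: "f \<in> sqint M \<Longrightarrow> qip M f f = of_real (qn2 M f)"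
  unfolding qip_def qn2_def qcnj_mult_self by (simp add: sqint_integrable del: of_real_power)

lemma qn2_nonneg [simp]: "0 \<le> qn2 M f"
  by (simp add: qn2_def)

lemma qn2_cong_AE:
  assumes "f \<in> borel_measurable M" "g \<in> borel_measurable M" "AE x in M. f x = g x"
  shows "qn2 M f = qn2 M g"
proof -
  note [measurable] = assms(1,2)
  show ?thesis
    unfolding qn2_def by (rule integral_cong_AE) (use assms(3) in auto)
qed

lemma qip_cong_AE:
  assumes "f \<in> borel_measurable M" "g \<in> borel_measurable M" "h \<in> borel_measurable M"
    and "AE x in M. f x = g x"
  shows "qip M h f = qip M h g"
proof -
  note [measurable] = assms(1-3)
  show ?thesis
    unfolding qip_def by (rule integral_cong_AE) (use assms(4) in auto)
qed

lemma qn2_minus: "qn2 M (\<lambda>x. f x - g x) = qn2 M (\<lambda>x. g x - f x)"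
  by (simp add: qn2_def norm_minus_commute)

lemma qn2_diff:
  assumes "f \<in> sqint M" "g \<in> sqint M"
  shows "qn2 M (\<lambda>x. f x - g x) = qn2 M f + qn2 M g - 2 * q1 (qip M g f)"
proof -
  have "q1 (qip M g f) = (\<integral>x. q1 (qcnj (g x) * f x) \<partial>M)"
    unfolding qip_def
    by (rule integral_bounded_linear[OF bounded_linear_q_sel(1) qip_integrable, symmetric]) fact+
  moreover have "integrable M (\<lambda>x. q1 (qcnj (g x) * f x))"
    by (rule integrable_bounded_linear[OF bounded_linear_q_sel(1) qip_integrable]) fact+
  ultimately show ?thesis
    using assms[THEN sqint_integrable] by (simp add: qn2_def norm_diff_sq_quat)
qed

lemma qn2_add_le:
  assumes "f \<in> sqint M" "g \<in> sqint M"
  shows "qn2 M (\<lambda>x. f x + g x) \<le> 2 * qn2 M f + 2 * qn2 M g"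
proof -
  have "qn2 M (\<lambda>x. f x + g x) \<le> (\<integral>x. 2 * (norm (f x))\<^sup>2 + 2 * (norm (g x))\<^sup>2 \<partial>M)"
    unfolding qn2_def
    by (rule integral_mono) (use assms sqint_add[OF assms] in \<open>auto simp: sqint_def norm_add_sq_le\<close>)
  also have "\<dots> = 2 * qn2 M f + 2 * qn2 M g"
    using assms by (simp add: sqint_def qn2_def)
  finally show ?thesis .
qed

lemma qn2_add_orthogonal:
  assumes "f \<in> sqint M" "g \<in> sqint M" "qip M f g = 0"
  shows "qn2 M (\<lambda>x. f x + g x) = qn2 M f + qn2 M g"
proof -
  have "qip M g f = 0"
    using qip_commute[OF assms(1,2)] assms(3) by simp
  with assms have "qip M g (\<lambda>x. f x + g x) = of_real (qn2 M g)"
    by (simp add: qip_add_right qip_self)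
  \<comment> \<open>Polarisation is applied to the difference (f + g) - g, whose squared norm is
    known, and solved for the squared norm of f + g.\<close>
  then have "qn2 M (\<lambda>x. f x + g x - g x) = qn2 M (\<lambda>x. f x + g x) + qn2 M g - 2 * qn2 M g"
    using qn2_diff[OF sqint_add[OF assms(1,2)] assms(2)] by simp
  then show ?thesis by simp
qed

lemma qn2_sum_orthogonal:
  assumes "finite A" "\<And>i. f i \<in> sqint M" "\<And>i j. i \<noteq> j \<Longrightarrow> qip M (f i) (f j) = 0"
  shows "qn2 M (\<lambda>x. \<Sum>i\<in>A. f i x) = (\<Sum>i\<in>A. qn2 M (f i))"
  using assms(1)
proof induction
  case (insert i A)
  have "qip M (f i) (\<lambda>x. \<Sum>j\<in>A. f j x) = (\<Sum>j\<in>A. qip M (f i) (f j))"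
    by (rule qip_sum_right) (rule assms(2))+
  also have "\<dots> = 0"
    by (intro sum.neutral ballI assms(3)) (use insert.hyps in auto)
  finally show ?case
    using insert by (simp add: qn2_add_orthogonal assms(2) sqint_sum)
qed (simp add: qn2_def)

lemma qip_mult_left:
  assumes "f \<in> sqint M" "g \<in> sqint M"
  shows "qip M (\<lambda>x. f x * c) g = qcnj c * qip M f g"
proof -
  have "qip M (\<lambda>x. f x * c) g = qcnj (qip M g (\<lambda>x. f x * c))"
    by (rule qip_commute) (intro assms sqint_mult_right)+
  also have "\<dots> = qcnj c * qcnj (qip M g f)"
    using assms by (simp add: qip_mult_right qcnj_mult)
  finally show ?thesis using qip_commute[OF assms(2,1)] by simp
qed

lemma qip_add_left:
  assumes "f \<in> sqint M" "g \<in> sqint M" "h \<in> sqint M"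
  shows "qip M (\<lambda>x. f x + g x) h = qip M f h + qip M g h"
proof -
  have "qip M (\<lambda>x. f x + g x) h = qcnj (qip M h (\<lambda>x. f x + g x))"
    by (rule qip_commute) (intro assms sqint_add)+
  also have "\<dots> = qcnj (qip M h f) + qcnj (qip M h g)"
    using assms by (simp add: qip_add_right)
  finally show ?thesis
    using qip_commute[OF assms(3,1)] qip_commute[OF assms(3,2)] by simp
qed

section \<open>Definiteness, Cauchy--Schwarz and convergence in mean\<close>

lemma qn2_eq_0_iff: "f \<in> sqint M \<Longrightarrow> qn2 M f = 0 \<longleftrightarrow> (AE x in M. f x = 0)"
  unfolding qn2_def by (subst integral_nonneg_eq_0_iff_AE) (auto simp: sqint_def)

text \<open>The scalar optimisation behind Cauchy--Schwarz: t = a / A balances the right-hand side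
  and leaves a \<le> B * A / a.\<close>

lemma mult_le_of_weighted_sum:
  fixes a A B :: real
  assumes "0 \<le> a" "0 \<le> A" "0 \<le> B" "\<And>t. t > 0 \<Longrightarrow> 2 * a \<le> t * A + B / t"
  shows "a\<^sup>2 \<le> A * B"
proof (cases "a = 0")
  case True then show ?thesis using assms by simp
next
  case False
  then have a: "a > 0" using assms by simp
  show ?thesis
  proof (cases "A = 0")
    case True
    \<comment> \<open>With A = 0 there is no optimal t; this one is large enough for B / t \<le> a,
      which contradicts a > 0.\<close>
    have "2 * a \<le> B / (B / a + 1)" using assms(4)[of "B / a + 1"] True a assms(3)
      by (simp add: add_nonneg_pos)
    also have "\<dots> \<le> a" using a assms(3) by (simp add: field_simps)
    finally show ?thesis using a by simp
  next
    case False
    then have "A > 0" using assms by simp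
    with assms(4)[of "a / A"] a have "2 * a \<le> a + B * A / a" by simp
    then show ?thesis using a by (simp add: field_simps power2_eq_square)
  qed
qed

text \<open>Taking the norm inside the integral first leaves a statement about the real functions
  \<open>norm (f x)\<close> and \<open>norm (g x)\<close>, so noncommutativity disappears.\<close>

lemma qip_Cauchy_Schwarz:
  assumes "f \<in> sqint M" "g \<in> sqint M"
  shows "(norm (qip M f g))\<^sup>2 \<le> qn2 M f * qn2 M g"
proof -
  have "norm (qip M f g) \<le> (\<integral>x. norm (f x) * norm (g x) \<partial>M)"
    using integral_norm_bound[of M "\<lambda>x. qcnj (f x) * g x"] by (simp add: qip_def norm_mult_quat)
  moreover have "(\<integral>x. norm (f x) * norm (g x) \<partial>M)\<^sup>2 \<le> qn2 M f * qn2 M g"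
  proof (rule mult_le_of_weighted_sum)
    fix t :: real assume t: "t > 0"
    have "2 * (\<integral>x. norm (f x) * norm (g x) \<partial>M) = (\<integral>x. 2 * (norm (f x) * norm (g x)) \<partial>M)"
      by simp
    also have "\<dots> \<le> (\<integral>x. t * (norm (f x))\<^sup>2 + (norm (g x))\<^sup>2 / t \<partial>M)"
    proof (rule integral_mono)
      fix x
      show "2 * (norm (f x) * norm (g x)) \<le> t * (norm (f x))\<^sup>2 + (norm (g x))\<^sup>2 / t"
        using two_mult_le_sq[of "sqrt t * norm (f x)" "norm (g x) / sqrt t"] t
        by (simp add: power_mult_distrib power_divide)
    qed (use assms sqint_integrable_mult_norm[OF assms] in \<open>auto simp: sqint_def\<close>)
    also have "\<dots> = t * qn2 M f + qn2 M g / t"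
      using assms by (simp add: sqint_def qn2_def)
    finally show "2 * (\<integral>x. norm (f x) * norm (g x) \<partial>M) \<le> t * qn2 M f + qn2 M g / t" .
  qed simp_all
  ultimately show ?thesis
    by (meson norm_ge_zero order_trans power_mono)
qed

lemma qip_tendsto:
  assumes "g \<in> sqint M" "f \<in> sqint M" "\<And>n. u n \<in> sqint M"
    and "(\<lambda>n. qn2 M (\<lambda>x. f x - u n x)) \<longlonglongrightarrow> 0"
  shows "(\<lambda>n. qip M g (u n)) \<longlonglongrightarrow> qip M g f"
proof -
  have "(\<lambda>n. sqrt (qn2 M g * qn2 M (\<lambda>x. f x - u n x))) \<longlonglongrightarrow> 0"
    using tendsto_real_sqrt[OF tendsto_mult_right_zero[OF assms(4), of "qn2 M g"]] by simp
  then have "(\<lambda>n. qip M g f - qip M g (u n)) \<longlonglongrightarrow> 0"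
  proof (rule Lim_null_comparison[rotated], intro always_eventually allI)
    fix n
    show "norm (qip M g f - qip M g (u n)) \<le> sqrt (qn2 M g * qn2 M (\<lambda>x. f x - u n x))"
      using qip_Cauchy_Schwarz[OF assms(1) sqint_diff[OF assms(2) assms(3)[of n]]] assms
      by (simp add: qip_diff_right real_le_rsqrt)
  qed
  from tendsto_diff[OF tendsto_const[of "qip M g f"] this] show ?thesis by simp
qed

text \<open>A uniform bound on squared norms replaces a dominating function. This is how almost
  everywhere limits become limits in mean, both for Riesz--Fischer and for orthogonal
  series.\<close>

lemma sqint_Fatou:
  assumes f: "f \<in> borel_measurable M" and u: "\<And>n. u n \<in> sqint M"
    and lim: "AE x in M. (\<lambda>n. u n x) \<longlonglongrightarrow> f x"
    and B: "\<And>n. qn2 M (u n) \<le> B"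
  shows "f \<in> sqint M" "qn2 M f \<le> B"
proof -
  note [measurable] = f u[THEN sqint_measurable]
  have B0: "0 \<le> B" using B[of 0] qn2_nonneg order_trans by blast
  have "(\<integral>\<^sup>+x. ennreal ((norm (f x))\<^sup>2) \<partial>M) = (\<integral>\<^sup>+x. liminf (\<lambda>n. ennreal ((norm (u n x))\<^sup>2)) \<partial>M)"
  proof (rule nn_integral_cong_AE, use lim in eventually_elim)
    case (elim x)
    have "(\<lambda>n. ennreal ((norm (u n x))\<^sup>2)) \<longlonglongrightarrow> ennreal ((norm (f x))\<^sup>2)"
      by (intro tendsto_ennrealI tendsto_intros elim)
    from lim_imp_Liminf[OF _ this] show ?case by simp
  qed
  also have "\<dots> \<le> liminf (\<lambda>n. (\<integral>\<^sup>+x. ennreal ((norm (u n x))\<^sup>2) \<partial>M))"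
    by (rule nn_integral_liminf) measurable
  also have "\<dots> = liminf (\<lambda>n. ennreal (qn2 M (u n)))"
    unfolding qn2_def using u by (simp add: nn_integral_eq_integral sqint_integrable)
  also have "\<dots> \<le> limsup (\<lambda>n. ennreal (qn2 M (u n)))"
    by (rule Liminf_le_Limsup) simp
  also have "\<dots> \<le> ennreal B"
    by (rule Limsup_bounded) (simp add: B ennreal_leI)
  finally have *: "(\<integral>\<^sup>+x. ennreal ((norm (f x))\<^sup>2) \<partial>M) \<le> ennreal B" .
  have "integrable M (\<lambda>x. (norm (f x))\<^sup>2)"
    using * by (intro integrableI_bounded) (auto simp: order_le_less_trans)
  then show "f \<in> sqint M" by (simp add: sqint_def)
  then show "qn2 M f \<le> B"
    using * B0 by (simp add: qn2_def nn_integral_eq_integral sqint_integrable)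
qed

text \<open>Riesz--Fischer. On a finite measure space the weight \<open>|v| \<le> 2^i |v|\<^sup>2 + 2^-i\<close> turns fast
  \<open>L\<^sup>2\<close> convergence of the increments into absolute convergence almost everywhere.\<close>

lemma (in finite_measure) sqint_complete:
  assumes u: "\<And>n. u n \<in> sqint M"
    and Cauchy: "\<And>e. e > 0 \<Longrightarrow> \<exists>N. \<forall>m\<ge>N. \<forall>n\<ge>N. qn2 M (\<lambda>x. u m x - u n x) \<le> e"
  obtains f where "f \<in> sqint M" "(\<lambda>n. qn2 M (\<lambda>x. f x - u n x)) \<longlonglongrightarrow> 0"
proof -
  \<comment> \<open>The rate (1/4)^i is chosen so that the factor 2^i from the pointwise weighting
    still leaves the summable (1/2)^i.\<close>
  have "\<exists>N. \<forall>m\<ge>N. \<forall>n\<ge>N. qn2 M (\<lambda>x. u m x - u n x) \<le> (1/4) ^ i" for i :: nat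
    by (rule Cauchy) simp
  then obtain N where N: "\<And>i m n. m \<ge> N i \<Longrightarrow> n \<ge> N i \<Longrightarrow> qn2 M (\<lambda>x. u m x - u n x) \<le> (1/4) ^ i"
    by metis
  \<comment> \<open>Adding up the thresholds yields an index s j beyond N i for every i \<le> j,
    which is all that is required of the subsequence.\<close>
  define s where "s i = (\<Sum>j\<le>i. N j)" for i
  have sN: "s j \<ge> N i" if "i \<le> j" for i j
    unfolding s_def using that by (intro member_le_sum) auto
  define v where "v i = u (s i)" for i
  have v: "v i \<in> sqint M" for i by (simp add: v_def u)
  note [measurable] = u[THEN sqint_measurable] v[THEN sqint_measurable]
  define d where "d i x = norm (v (Suc i) x - v i x)" for i x
  have [measurable]: "d i \<in> borel_measurable M" for i unfolding d_def by measurable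
  have d_sq: "(\<lambda>x. v (Suc i) x - v i x) \<in> sqint M" for i
    by (intro sqint_diff v)
  \<comment> \<open>The 1 pays for the increment, since 2^i * (1/4)^i = (1/2)^i, and the total mass
    pays for integrating the constant (1/2)^i.\<close>
  define C where "C = 1 + measure M (space M)"
  have d_int: "(\<integral>\<^sup>+x. ennreal (d i x) \<partial>M) \<le> ennreal ((1/2) ^ i * C)" for i
  proof -
    have "(\<integral>\<^sup>+x. ennreal (d i x) \<partial>M) \<le> (\<integral>\<^sup>+x. ennreal (2 ^ i * (d i x)\<^sup>2 + (1/2) ^ i) \<partial>M)"
    proof (rule nn_integral_mono, rule ennreal_leI)
      fix x
      have "0 \<le> d i x" by (simp add: d_def)
      have "d i x = (sqrt (2 ^ i) * d i x) * sqrt ((1/2) ^ i)"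
        by (simp add: real_sqrt_mult[symmetric] power_one_over)
      also have "\<dots> \<le> 2 * ((sqrt (2 ^ i) * d i x) * sqrt ((1/2) ^ i))"
        using \<open>0 \<le> d i x\<close> by simp
      also have "\<dots> \<le> (sqrt (2 ^ i) * d i x)\<^sup>2 + (sqrt ((1/2) ^ i))\<^sup>2"
        by (rule two_mult_le_sq)
      finally show "d i x \<le> 2 ^ i * (d i x)\<^sup>2 + (1/2) ^ i"
        by (simp add: power_mult_distrib)
    qed
    also have "\<dots> = ennreal (\<integral>x. 2 ^ i * (d i x)\<^sup>2 + (1/2) ^ i \<partial>M)"
      using d_sq[of i, THEN sqint_integrable]
      by (intro nn_integral_eq_integral) (auto simp: d_def)
    also have "(\<integral>x. 2 ^ i * (d i x)\<^sup>2 + (1/2) ^ i \<partial>M) =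
        2 ^ i * qn2 M (\<lambda>x. v (Suc i) x - v i x) + (1/2) ^ i * measure M (space M)"
      using d_sq[of i, THEN sqint_integrable] by (simp add: d_def qn2_def)
    also have "\<dots> \<le> 2 ^ i * (1/4) ^ i + (1/2) ^ i * measure M (space M)"
      using N[of i "s (Suc i)" "s i"] sN[of i i] sN[of i "Suc i"] by (simp add: v_def)
    also have "\<dots> = (1/2) ^ i * C"
      by (simp add: C_def distrib_left power_mult_distrib[symmetric])
    finally show ?thesis using ennreal_leI by blast
  qed
  have "(\<integral>\<^sup>+x. (\<Sum>i. ennreal (d i x)) \<partial>M) = (\<Sum>i. \<integral>\<^sup>+x. ennreal (d i x) \<partial>M)"
    by (rule nn_integral_suminf) measurable
  also have "\<dots> \<le> (\<Sum>i. ennreal ((1/2) ^ i * C))"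
    by (intro suminf_le d_int) auto
  also have "\<dots> = ennreal (\<Sum>i. (1/2) ^ i * C)"
    by (rule suminf_ennreal2) (auto simp: C_def intro!: summable_mult2 summable_geometric add_nonneg_nonneg)
  finally have "(\<integral>\<^sup>+x. (\<Sum>i. ennreal (d i x)) \<partial>M) \<noteq> \<infinity>"
    by (auto simp: top_unique)
  then have "AE x in M. (\<Sum>i. ennreal (d i x)) \<noteq> \<infinity>"
    by (intro nn_integral_PInf_AE) measurable
  then have conv: "AE x in M. (\<lambda>i. v i x) \<longlonglongrightarrow> lim (\<lambda>i. v i x)"
  proof eventually_elim
    case (elim x)
    then have "summable (\<lambda>i. norm (v (Suc i) x - v i x))"
      by (intro summable_suminf_not_top) (auto simp: d_def)
    then have "summable (\<lambda>i. v (Suc i) x - v i x)"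
      by (rule summable_norm_cancel)
    then have "convergent (\<lambda>n. \<Sum>i<n. v (Suc i) x - v i x)"
      by (simp add: summable_iff_convergent)
    then have "convergent (\<lambda>n. v n x - v 0 x)"
      using sum_lessThan_telescope[of "\<lambda>i. v i x"] by simp
    then have "convergent (\<lambda>n. v n x)"
      using convergent_diff_const_right_iff by blast
    then show ?case by (simp add: convergent_LIMSEQ_iff)
  qed
  \<comment> \<open>\<open>lim\<close> is defined at every point, so f is measurable whatever it
    does on the exceptional null set.\<close>
  define f where "f x = lim (\<lambda>i. v i x)" for x
  have [measurable]: "f \<in> borel_measurable M"
    unfolding f_def by measurable
  \<comment> \<open>Each u n with n \<ge> N i is compared with the later members v (j + i), and
    Fatou lets j grow. The whole sequence is controlled, not only the subsequence, and n = N 0 shows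
    that f itself is square integrable.\<close>
  have bound: "(\<lambda>x. f x - u n x) \<in> sqint M \<and> qn2 M (\<lambda>x. f x - u n x) \<le> (1/4) ^ i" if "n \<ge> N i" for n i
  proof -
    have "AE x in M. (\<lambda>j. v (j + i) x - u n x) \<longlonglongrightarrow> f x - u n x"
      using conv
      by eventually_elim
        (auto simp: f_def intro!: tendsto_diff LIMSEQ_ignore_initial_segment[of "\<lambda>j. v j _"])
    moreover have "(\<lambda>x. v (j + i) x - u n x) \<in> sqint M" for j
      by (intro sqint_diff v u)
    moreover have "qn2 M (\<lambda>x. v (j + i) x - u n x) \<le> (1/4) ^ i" for j
      unfolding v_def by (intro N sN that) simp
    ultimately show ?thesis
      using sqint_Fatou[of "\<lambda>x. f x - u n x" M "\<lambda>j x. v (j + i) x - u n x" "(1/4) ^ i"]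
      by auto
  qed
  show ?thesis
  proof
    show "f \<in> sqint M"
      using sqint_add[OF conjunct1[OF bound[of 0 "N 0"]] u[of "N 0"]] by simp
    show "(\<lambda>n. qn2 M (\<lambda>x. f x - u n x)) \<longlonglongrightarrow> 0"
    proof (rule LIMSEQ_I)
      fix r :: real assume "r > 0"
      then obtain i where i: "(1/4 :: real) ^ i < r"
        using real_arch_pow_inv[of r "1/4"] by auto
      show "\<exists>no. \<forall>n\<ge>no. norm (qn2 M (\<lambda>x. f x - u n x) - 0) < r"
        using bound[of i] i by (intro exI[of _ "N i"]) (auto intro: order_le_less_trans)
    qed
  qed
qed

section \<open>Orthogonal families, Bessel's inequality and orthogonal series\<close>

locale quat_orthogonal = finite_measure M for M :: "'a measure" +
  fixes e :: "'i \<Rightarrow> 'a \<Rightarrow> quat" and N :: "'i \<Rightarrow> real"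
  assumes e_sqint [simp]: "e i \<in> sqint M"
    and N_pos: "0 < N i"
    and qip_e: "qip M (e i) (e j) = of_real (if i = j then N i else 0)"
begin

definition comb :: "'i set \<Rightarrow> ('i \<Rightarrow> quat) \<Rightarrow> 'a \<Rightarrow> quat"
  where "comb A c x = (\<Sum>i\<in>A. e i x * c i)"

text \<open>The family is orthogonal but not normalised, so the Fourier coefficient carries the
  division by the squared norm \<open>N i\<close>.\<close>

definition coef :: "('a \<Rightarrow> quat) \<Rightarrow> 'i \<Rightarrow> quat"
  where "coef f i = qip M (e i) f /\<^sub>R N i"

lemma comb_sqint [simp]: "comb A c \<in> sqint M"
  unfolding comb_def[abs_def] by (intro sqint_sum sqint_mult_right) simp

lemma qip_e_comb: "finite A \<Longrightarrow> qip M (e i) (comb A c) = (if i \<in> A then of_real (N i) * c i else 0)"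
  unfolding comb_def[abs_def]
  by (simp add: qip_sum_right sqint_mult_right qip_mult_right qip_e if_distrib[of of_real]
      if_distrib[of "\<lambda>x. x * _"] sum.delta cong: if_cong)

lemma qip_comb_left:
  assumes "f \<in> sqint M"
  shows "qip M (comb A c) f = (\<Sum>i\<in>A. qcnj (c i) * qip M (e i) f)"
proof -
  have "qip M (comb A c) f = qcnj (qip M f (comb A c))"
    by (rule qip_commute) (simp_all add: assms)
  also have "qip M f (comb A c) = (\<Sum>i\<in>A. qip M f (e i) * c i)"
    unfolding comb_def[abs_def] by (simp add: assms qip_sum_right sqint_mult_right qip_mult_right)
  also have "qcnj \<dots> = (\<Sum>i\<in>A. qcnj (c i) * qip M (e i) f)"
    by (simp add: qcnj_sum qcnj_mult qip_commute[OF assms e_sqint, symmetric])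
  finally show ?thesis .
qed

lemma of_real_mult_qcnj: "qcnj x * (of_real r * x) = of_real (r * (norm x)\<^sup>2)"
  by (simp add: of_real_def qcnj_mult_self)

lemma qn2_comb:
  assumes "finite A"
  shows "qn2 M (comb A c) = (\<Sum>i\<in>A. N i * (norm (c i))\<^sup>2)"
proof -
  have "(of_real (qn2 M (comb A c)) :: quat) = of_real (\<Sum>i\<in>A. N i * (norm (c i))\<^sup>2)"
    by (simp add: qip_self[symmetric] qip_comb_left qip_e_comb assms of_real_mult_qcnj)
  then show ?thesis by (simp only: of_real_eq_iff)
qed

lemma qip_e_coef: "qip M (e i) f = of_real (N i) * coef f i"
  using N_pos[of i] by (simp add: coef_def scaleR_conv_of_real mult.assoc[symmetric] flip: of_real_mult)

lemma Bessel:
  assumes "finite A" "f \<in> sqint M"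
  shows "(\<Sum>i\<in>A. N i * (norm (coef f i))\<^sup>2) \<le> qn2 M f"
proof -
  have "qip M (comb A (coef f)) f = of_real (\<Sum>i\<in>A. N i * (norm (coef f i))\<^sup>2)"
    by (simp add: qip_comb_left assms qip_e_coef of_real_mult_qcnj)
  then have "qn2 M (\<lambda>x. f x - comb A (coef f) x) = qn2 M f - (\<Sum>i\<in>A. N i * (norm (coef f i))\<^sup>2)"
    by (simp add: qn2_diff assms qn2_comb del: of_real_sum of_real_mult of_real_power)
  then show ?thesis using qn2_nonneg[of M "\<lambda>x. f x - comb A (coef f) x"] by linarith
qed

lemma coef_diff: "f \<in> sqint M \<Longrightarrow> g \<in> sqint M \<Longrightarrow> coef (\<lambda>x. f x - g x) i = coef f i - coef g i"
  by (simp add: coef_def qip_diff_right scaleR_right_diff_distrib)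

end

text \<open>Pointwise convergent orthogonal series: Fatou's lemma identifies the pointwise sum with the
  \<open>L\<^sup>2\<close> sum.\<close>

locale quat_orthogonal_series = quat_orthogonal M e N
  for M :: "'a measure" and e :: "'i \<Rightarrow> 'a \<Rightarrow> quat" and N +
  fixes r :: "nat \<Rightarrow> 'i" and c :: "'i \<Rightarrow> quat" and F :: "'a \<Rightarrow> quat"
  assumes inj_r: "inj r"
    and summable_c: "summable (\<lambda>j. N (r j) * (norm (c (r j)))\<^sup>2)"
    and sums_F: "x \<in> space M \<Longrightarrow> (\<lambda>j. e (r j) x * c (r j)) sums F x"
begin

lemma partial_eq: "(\<Sum>j<n. e (r j) x * c (r j)) = comb (r ` {..<n}) c x"
  unfolding comb_def by (subst sum.reindex) (use inj_r in \<open>auto intro: inj_on_subset\<close>)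

lemma comb_tendsto: "x \<in> space M \<Longrightarrow> (\<lambda>n. comb (r ` {..<n}) c x) \<longlonglongrightarrow> F x"
  using sums_F unfolding sums_def partial_eq .

lemma F_measurable: "F \<in> borel_measurable M"
  by (rule borel_measurable_LIMSEQ_metric[OF sqint_measurable[OF comb_sqint] comb_tendsto])

lemma qn2_comb_diff:
  assumes "n \<le> m"
  shows "qn2 M (\<lambda>x. comb (r ` {..<m}) c x - comb (r ` {..<n}) c x)
    = (\<Sum>j\<in>{n..<m}. N (r j) * (norm (c (r j)))\<^sup>2)"
proof -
  have sub: "r ` {..<m} - r ` {..<n} = r ` {n..<m}"
    by (subst image_set_diff[OF inj_r, symmetric]) (rule arg_cong[where f = "image r"], auto)
  have "comb (r ` {..<m}) c x - comb (r ` {..<n}) c x = comb (r ` {n..<m}) c x" for x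
    unfolding comb_def sub[symmetric] using assms by (subst sum_diff) auto
  then show ?thesis
    by (simp add: qn2_comb sum.reindex inj_on_subset[OF inj_r])
qed

text \<open>Fatou is applied after removing the first n terms. Pythagoras evaluates the remaining
  finite blocks, so the bound is the tail of a convergent series and tends to 0 with n.\<close>

lemma tail: "(\<lambda>x. F x - comb (r ` {..<n}) c x) \<in> sqint M"
    "qn2 M (\<lambda>x. F x - comb (r ` {..<n}) c x) \<le> (\<Sum>j. N (r (j + n)) * (norm (c (r (j + n))))\<^sup>2)"
proof -
  note [measurable] = F_measurable sqint_measurable[OF comb_sqint]
  have lim: "AE x in M. (\<lambda>k. comb (r ` {..<k + n}) c x - comb (r ` {..<n}) c x)
      \<longlonglongrightarrow> F x - comb (r ` {..<n}) c x"
    by (intro AE_I2 tendsto_intros LIMSEQ_ignore_initial_segment[of "\<lambda>k. comb (r ` {..<k}) c _"] comb_tendsto)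
  have bound: "qn2 M (\<lambda>x. comb (r ` {..<k + n}) c x - comb (r ` {..<n}) c x)
      \<le> (\<Sum>j. N (r (j + n)) * (norm (c (r (j + n))))\<^sup>2)" for k
  proof -
    have "qn2 M (\<lambda>x. comb (r ` {..<k + n}) c x - comb (r ` {..<n}) c x)
      = (\<Sum>j<k. N (r (j + n)) * (norm (c (r (j + n))))\<^sup>2)"
      by (subst qn2_comb_diff, simp)
         (rule sum.reindex_bij_witness[of _ "\<lambda>j. j + n" "\<lambda>j. j - n"], auto)
    also have "\<dots> \<le> (\<Sum>j. N (r (j + n)) * (norm (c (r (j + n))))\<^sup>2)"
      by (intro sum_le_suminf summable_ignore_initial_segment[OF summable_c])
         (auto intro!: mult_nonneg_nonneg less_imp_le[OF N_pos])
    finally show ?thesis .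
  qed
  show "(\<lambda>x. F x - comb (r ` {..<n}) c x) \<in> sqint M"
    by (rule sqint_Fatou(1)[OF _ _ lim bound]) (auto intro: sqint_diff)
  show "qn2 M (\<lambda>x. F x - comb (r ` {..<n}) c x) \<le> (\<Sum>j. N (r (j + n)) * (norm (c (r (j + n))))\<^sup>2)"
    by (rule sqint_Fatou(2)[OF _ _ lim bound]) (auto intro: sqint_diff)
qed

lemma F_sqint: "F \<in> sqint M"
  using sqint_add[OF tail(1)[of 0] comb_sqint[of "r ` {..<0}" c]] by simp

lemma qn2_tendsto: "(\<lambda>n. qn2 M (\<lambda>x. F x - comb (r ` {..<n}) c x)) \<longlonglongrightarrow> 0"
  by (rule Lim_null_comparison[OF _ suminf_exist_split2[OF summable_c]]) (simp add: tail(2))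

text \<open>Pairing with the partial sums becomes constant once the index j with r j = i, if there
  is one, has been passed.\<close>

lemma qip_e_F: "qip M (e i) F = (if i \<in> range r then of_real (N i) * c i else 0)"
proof (rule LIMSEQ_unique)
  show "(\<lambda>n. qip M (e i) (comb (r ` {..<n}) c)) \<longlonglongrightarrow> qip M (e i) F"
    by (rule qip_tendsto[OF _ F_sqint _ qn2_tendsto]) simp_all
  have "eventually (\<lambda>n. i \<in> range r \<longrightarrow> i \<in> r ` {..<n}) sequentially"
  proof (cases "i \<in> range r")
    case True
    then obtain j where "i = r j" by auto
    then show ?thesis by (intro impI eventually_mono[OF eventually_gt_at_top[of j]]) auto
  qed simp
  then have "eventually (\<lambda>n. qip M (e i) (comb (r ` {..<n}) c) =
      (if i \<in> range r then of_real (N i) * c i else 0)) sequentially"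
    by eventually_elim (auto simp: qip_e_comb)
  then show "(\<lambda>n. qip M (e i) (comb (r ` {..<n}) c)) \<longlonglongrightarrow>
      (if i \<in> range r then of_real (N i) * c i else 0)"
    by (rule tendsto_eventually)
qed

text \<open>Orthogonality to every term survives the limit in mean; this later separates
  \<open>SR2 k\<close> from \<open>SR2 l\<close>.\<close>

lemma qip_F_eq_0:
  assumes "g \<in> sqint M" "\<And>j. qip M (e (r j)) g = 0"
  shows "qip M g F = 0"
proof (rule LIMSEQ_unique)
  show "(\<lambda>n. qip M g (comb (r ` {..<n}) c)) \<longlonglongrightarrow> qip M g F"
    by (rule qip_tendsto[OF assms(1) F_sqint _ qn2_tendsto]) simp_all
  have "qip M g (comb (r ` {..<n}) c) = 0" for n
  proof -
    have "qip M g (comb (r ` {..<n}) c) = qcnj (qip M (comb (r ` {..<n}) c) g)"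
      by (rule qip_commute) (simp_all add: assms)
    also have "qip M (comb (r ` {..<n}) c) g = 0"
      unfolding qip_comb_left[OF assms(1)] by (rule sum.neutral) (auto simp: assms(2))
    finally show ?thesis by simp
  qed
  then show "(\<lambda>n. qip M g (comb (r ` {..<n}) c)) \<longlonglongrightarrow> 0" by simp
qed

lemma coef_F: "coef F i = (if i \<in> range r then c i else 0)"
  using N_pos[of i] by (simp add: coef_def qip_e_F scaleR_conv_of_real mult.assoc[symmetric] flip: of_real_mult)

lemma qn2_F_le: "qn2 M F \<le> (\<Sum>j. N (r j) * (norm (c (r j)))\<^sup>2)"
  using tail(2)[of 0] by (simp add: comb_def)

end

section \<open>Complex Hermite polynomials\<close>

text \<open>The coefficient m! n! / (j! (m-j)! (n-j)!) is written as j! times two binomials. These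
  vanish beyond \<open>min m n\<close>, so the summation range can be enlarged freely in the
  recurrence (\<open>hermite_eq_sum\<close>).\<close>

definition hermite :: "nat \<Rightarrow> nat \<Rightarrow> complex \<Rightarrow> complex"
  where "hermite m n z = (\<Sum>j\<le>min m n. of_real ((- 1) ^ j * fact j * real (m choose j) * real (n choose j))
    * (z ^ (m - j) * cnj z ^ (n - j)))"

lemma hermite_eq_sum:
  assumes "min m n \<le> K"
  shows "hermite m n z = (\<Sum>j\<le>K. of_real ((- 1) ^ j * fact j * real (m choose j) * real (n choose j))
    * (z ^ (m - j) * cnj z ^ (n - j)))"
  unfolding hermite_def
  by (rule sum.mono_neutral_left) (use assms in \<open>auto simp: not_le min_less_iff_disj\<close>)

lemma hermite_0_left [simp]: "hermite 0 n z = cnj z ^ n"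
  by (simp add: hermite_def)

lemma hermite_cnj: "hermite n m z = cnj (hermite m n z)"
  by (simp add: hermite_def min.commute mult_ac)

text \<open>Pascal's rule splits the coefficient of \<open>Suc m choose Suc j\<close>, and n * (n-1
  choose j) = (j+1) * (n choose j+1) recognises the second part as a term of
  \<open>hermite m (n - 1)\<close>. At n = 0 the truncated n - 1 is harmless because of the factor
  n.\<close>

lemma hermite_Suc_left: "hermite (Suc m) n z = z * hermite m n z - of_nat n * hermite m (n - 1) z"
proof -
  let ?c = "\<lambda>m n j. (- 1) ^ j * fact j * real (m choose j) * real (n choose j)"
  let ?t = "\<lambda>m n j. of_real (?c m n j) * (z ^ (m - j) * cnj z ^ (n - j)) :: complex"
  have step: "?t (Suc m) n (Suc j) = z * ?t m n (Suc j) - of_nat n * ?t m (n - 1) j" if "j \<le> m" for j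
  proof -
    have nj: "real n * real ((n - 1) choose j) = real (Suc j) * real (n choose Suc j)"
    proof (cases n)
      case (Suc k)
      then show ?thesis
        using Suc_times_binomial_eq[of k j] by (simp only: diff_Suc_1 mult.commute flip: of_nat_mult)
    qed simp
    \<comment> \<open>At j = m truncated subtraction gives the wrong power of z, but the coefficient
      contains \<open>m choose Suc m\<close>, which is 0.\<close>
    have z1: "z * (of_real (?c m n (Suc j)) * (z ^ (m - Suc j) * w)) = of_real (?c m n (Suc j)) * (z ^ (m - j) * w)" for w
    proof (cases "j = m")
      case False
      with that have "z ^ (m - j) = z * z ^ (m - Suc j)"
        by (metis Suc_diff_Suc le_neq_implies_less power_Suc)
      then show ?thesis by simp
    qed simp
    have c: "?c (Suc m) n (Suc j) = ?c m n (Suc j) - real n * ?c m (n - 1) j"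
    proof -
      have "real n * ?c m (n - 1) j = (- 1) ^ j * fact j * real (m choose j) * (real n * real ((n - 1) choose j))"
        by simp
      also have "\<dots> = (- 1) ^ j * fact (Suc j) * real (m choose j) * real (n choose Suc j)"
        unfolding nj by simp
      finally show ?thesis by (simp add: algebra_simps)
    qed
    have "of_nat n * ?t m (n - 1) j = of_real (real n * ?c m (n - 1) j) * (z ^ (m - j) * cnj z ^ (n - Suc j))"
      by simp
    then show ?thesis
      unfolding z1 by (simp only: c of_real_diff diff_Suc_Suc left_diff_distrib)
  qed
  have "hermite (Suc m) n z = (\<Sum>j\<le>Suc m. ?t (Suc m) n j)"
    by (rule hermite_eq_sum) simp
  also have "\<dots> = z * (z ^ m * cnj z ^ n) + (\<Sum>j\<le>m. ?t (Suc m) n (Suc j))"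
    by (subst sum.atMost_Suc_shift) simp
  also have "(\<Sum>j\<le>m. ?t (Suc m) n (Suc j)) = (\<Sum>j\<le>m. z * ?t m n (Suc j) - of_nat n * ?t m (n - 1) j)"
    by (rule sum.cong[OF refl], rule step) simp
  also have "\<dots> = z * (\<Sum>j\<le>m. ?t m n (Suc j)) - of_nat n * (\<Sum>j\<le>m. ?t m (n - 1) j)"
    by (simp only: sum_subtractf sum_distrib_left)
  also have "(\<Sum>j\<le>m. ?t m (n - 1) j) = hermite m (n - 1) z"
    by (rule hermite_eq_sum[symmetric]) simp
  also have "z * (z ^ m * cnj z ^ n) + (z * (\<Sum>j\<le>m. ?t m n (Suc j)) - of_nat n * hermite m (n - 1) z)
    = z * (\<Sum>j\<le>Suc m. ?t m n j) - of_nat n * hermite m (n - 1) z"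
    by (subst sum.atMost_Suc_shift) (simp add: distrib_left)
  also have "(\<Sum>j\<le>Suc m. ?t m n j) = hermite m n z"
    by (rule hermite_eq_sum[symmetric]) simp
  finally show ?thesis .
qed

lemma hermite_Suc_right: "hermite m (Suc n) z = cnj z * hermite m n z - of_nat m * hermite (m - 1) n z"
  using hermite_Suc_left[of n m z]
  by (simp add: hermite_cnj[of m "Suc n"] hermite_cnj[of m n] hermite_cnj[of "m - Suc 0" n])

section \<open>Gaussian moments\<close>

text \<open>The unnormalised Gaussian: its total mass is pi (\<open>cmoment_0\<close>), the origin
  of the pi in all squared norms. It is built on pairs of reals so that Fubini applies coordinate by
  coordinate.\<close>

definition cgauss :: "complex measure"
  where "cgauss = distr (density lborel (\<lambda>p. ennreal (exp (- (norm p)\<^sup>2)))) borel (\<lambda>(x, y). Complex x y)"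

lemma measurable_Complex [measurable]:
  "f \<in> borel_measurable M \<Longrightarrow> g \<in> borel_measurable M \<Longrightarrow> (\<lambda>x. Complex (f x) (g x)) \<in> borel_measurable M"
  by (simp add: borel_measurable_complex_iff)

lemma measurable_fst_snd_borel [measurable]:
  "fst \<in> borel_measurable (borel :: (real \<times> real) measure)"
  "snd \<in> borel_measurable (borel :: (real \<times> real) measure)"
  by (intro borel_measurable_continuous_onI continuous_intros)+

lemma sets_cgauss [measurable_cong]: "sets cgauss = sets borel"
  by (simp add: cgauss_def)

lemma integrable_cgauss_iff:
  fixes h :: "complex \<Rightarrow> 'a::{banach, second_countable_topology}"
  assumes [measurable]: "h \<in> borel_measurable borel"
  shows "integrable cgauss h \<longleftrightarrow>
    integrable lborel (\<lambda>(x, y). exp (- (x\<^sup>2 + y\<^sup>2)) *\<^sub>R h (Complex x y))"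
proof -
  have "integrable cgauss h \<longleftrightarrow> integrable lborel (\<lambda>p. exp (- (norm p)\<^sup>2) *\<^sub>R h (Complex (fst p) (snd p)))"
    unfolding cgauss_def by (simp add: integrable_distr_eq integrable_density case_prod_beta)
  then show ?thesis by (simp add: case_prod_beta' norm_prod_def)
qed

lemma integral_cgauss:
  fixes h :: "complex \<Rightarrow> 'a::{banach, second_countable_topology}"
  assumes [measurable]: "h \<in> borel_measurable borel"
  shows "integral\<^sup>L cgauss h = (\<integral>(x, y). exp (- (x\<^sup>2 + y\<^sup>2)) *\<^sub>R h (Complex x y) \<partial>lborel)"
proof -
  have "integral\<^sup>L cgauss h = (\<integral>p. exp (- (norm p)\<^sup>2) *\<^sub>R h (Complex (fst p) (snd p)) \<partial>lborel)"
    unfolding cgauss_def by (simp add: integral_distr integral_density case_prod_beta)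
  then show ?thesis by (simp add: case_prod_beta' norm_prod_def)
qed

section \<open>Domination by the Gaussian\<close>

lemma power_over_fact_le_exp:
  fixes x :: real
  assumes "x \<ge> 0"
  shows "x ^ n / fact n \<le> exp x"
proof -
  have "(\<Sum>k\<in>{n}. x ^ k /\<^sub>R fact k) \<le> (\<Sum>k. x ^ k /\<^sub>R fact k)"
    by (intro sum_le_suminf summable_exp_generic) (use assms in auto)
  then show ?thesis by (simp add: exp_def field_simps)
qed

text \<open>The series of exp (c r^2) contains only even powers, so r^n is first bounded by 1 +
  r^(2n).\<close>

lemma power_le_exp_sq:
  fixes r :: real
  assumes "r \<ge> 0" "c > 0"
  shows "r ^ n \<le> (1 + fact n / c ^ n) * exp (c * r\<^sup>2)"
proof -
  have "(c * r\<^sup>2) ^ n / fact n \<le> exp (c * r\<^sup>2)"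
    using assms by (intro power_over_fact_le_exp) simp
  then have "r ^ n * r ^ n \<le> fact n / c ^ n * exp (c * r\<^sup>2)"
    using assms by (simp add: field_simps power_mult_distrib power2_eq_square)
  moreover have "1 \<le> exp (c * r\<^sup>2)" using assms by simp
  moreover have "r ^ n \<le> 1 + r ^ n * r ^ n"
    using zero_le_power2[of "r ^ n - 1 / 2"] by (simp add: power2_eq_square algebra_simps)
  ultimately show ?thesis unfolding distrib_right by linarith
qed

lemma integrable_exp_neg_sq:
  assumes "c > 0"
  shows "integrable lborel (\<lambda>x::real. exp (- c * x\<^sup>2))"
proof -
  have "integrable lborel (\<lambda>x. sqrt (pi / c) * normal_density 0 (1 / sqrt (2 * c)) x)"
    using assms by (intro integrable_mult_right integrable_normal_density) simp
  then show ?thesis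
    using assms by (simp add: normal_density_def power_divide real_sqrt_divide field_simps)
qed

lemma integrable_lborel_prod:
  fixes f g :: "real \<Rightarrow> real"
  assumes f: "integrable lborel f" and g: "integrable lborel g"
  shows "integrable lborel (\<lambda>(x, y). f x * g y)"
proof -
  note [measurable] = borel_measurable_integrable[OF f] borel_measurable_integrable[OF g]
  have "integrable (lborel \<Otimes>\<^sub>M lborel) (\<lambda>(x, y). f x * g y)"
    by (rule lborel_pair.Fubini_integrable) (use f g in \<open>auto simp: abs_mult\<close>)
  then show ?thesis by (simp add: lborel_prod)
qed

lemma integral_lborel_fst:
  fixes f :: "real \<Rightarrow> real \<Rightarrow> 'a::{banach, second_countable_topology}"
  assumes "integrable lborel (\<lambda>(x, y). f x y)"
  shows "(\<integral>(x, y). f x y \<partial>lborel) = (\<integral>x. \<integral>y. f x y \<partial>lborel \<partial>lborel)"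
proof -
  show ?thesis using lborel_pair.integral_fst'[of "\<lambda>(x, y). f x y"] assms by (simp add: lborel_prod)
qed

lemma integral_lborel_snd:
  fixes f :: "real \<Rightarrow> real \<Rightarrow> 'a::{banach, second_countable_topology}"
  assumes "integrable lborel (\<lambda>(x, y). f x y)"
  shows "(\<integral>(x, y). f x y \<partial>lborel) = (\<integral>y. \<integral>x. f x y \<partial>lborel \<partial>lborel)"
proof -
  show ?thesis using lborel_pair.integral_snd[of f] assms by (simp add: lborel_prod)
qed

text \<open>Half of the Gaussian exponent absorbs the polynomial growth
  (\<open>power_le_exp_sq\<close> with c = 1/2); the other half is an integrable product of
  one-variable Gaussians.\<close>

lemma integrable_cgauss_poly:
  fixes h :: "complex \<Rightarrow> 'a::{banach, second_countable_topology}"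
  assumes [measurable]: "h \<in> borel_measurable borel" and bound: "\<And>z. norm (h z) \<le> B * norm z ^ n"
  shows "integrable cgauss h"
  unfolding integrable_cgauss_iff[OF assms(1)]
proof (rule Bochner_Integration.integrable_bound)
  define C where "C = \<bar>B\<bar> * (1 + fact n / (1/2) ^ n)"
  show "integrable lborel (\<lambda>(x, y). C * exp (- (1/2) * x\<^sup>2) * exp (- (1/2) * y\<^sup>2))"
    by (rule integrable_lborel_prod) (intro integrable_mult_right integrable_exp_neg_sq, simp)+
  show "AE p in lborel. norm (case p of (x, y) \<Rightarrow> exp (- (x\<^sup>2 + y\<^sup>2)) *\<^sub>R h (Complex x y)) \<le>
      norm (case p of (x, y) \<Rightarrow> C * exp (- (1/2) * x\<^sup>2) * exp (- (1/2) * y\<^sup>2))"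
  proof (rule AE_I2, clarify)
    fix x y :: real
    have "norm (h (Complex x y)) \<le> \<bar>B\<bar> * norm (Complex x y) ^ n"
      using bound[of "Complex x y"] by (rule order_trans) (simp add: mult_right_mono)
    also have "\<dots> \<le> \<bar>B\<bar> * ((1 + fact n / (1/2) ^ n) * exp (1/2 * (norm (Complex x y))\<^sup>2))"
      by (intro mult_left_mono power_le_exp_sq) auto
    also have "\<dots> = C * exp (1/2 * (x\<^sup>2 + y\<^sup>2))"
      by (simp add: C_def cmod_power2)
    finally have "exp (- (x\<^sup>2 + y\<^sup>2)) * norm (h (Complex x y)) \<le> exp (- (x\<^sup>2 + y\<^sup>2)) * (C * exp (1/2 * (x\<^sup>2 + y\<^sup>2)))"
      by (intro mult_left_mono) auto
    also have "\<dots> = C * exp (- (1/2) * x\<^sup>2) * exp (- (1/2) * y\<^sup>2)"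
      by (simp add: mult_exp_exp mult.left_commute[of _ C] mult.assoc field_simps)
    finally show "norm (exp (- (x\<^sup>2 + y\<^sup>2)) *\<^sub>R h (Complex x y)) \<le>
        norm (C * exp (- (1/2) * x\<^sup>2) * exp (- (1/2) * y\<^sup>2))"
      by simp
  qed
qed measurable

lemma integral_deriv_eq_0:
  fixes F f :: "real \<Rightarrow> 'a::euclidean_space"
  assumes F: "\<And>x. (F has_vector_derivative f x) (at x)"
    and f: "continuous_on UNIV f" and int: "integrable lborel f"
    and lim: "(F \<longlongrightarrow> 0) at_top" "(F \<longlongrightarrow> 0) at_bot"
  shows "integral\<^sup>L lborel f = 0"
proof -
  have "(LBINT x=-\<infinity>..\<infinity>. f x) = 0 - 0"
  proof (rule interval_integral_FTC_integrable[where F = F])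
    show "((F \<circ> real_of_ereal) \<longlongrightarrow> 0) (at_right (-\<infinity>))" "((F \<circ> real_of_ereal) \<longlongrightarrow> 0) (at_left \<infinity>)"
      using lim by (simp_all add: ereal_tendsto_simps)
  qed (use F f int in \<open>auto simp: continuous_on_eq_continuous_at set_integrable_def\<close>)
  then show ?thesis by (simp add: interval_lebesgue_integral_def set_lebesgue_integral_def)
qed

lemma tendsto_0_of_exp_sq_bound:
  fixes F :: "real \<Rightarrow> 'a::real_normed_vector"
  assumes "\<And>t. norm (F t) \<le> C * exp (- (1/2) * t\<^sup>2)"
  shows "(F \<longlongrightarrow> 0) at_top" "(F \<longlongrightarrow> 0) at_bot"
proof -
  have "((\<lambda>t::real. C * exp (- (1/2) * t\<^sup>2)) \<longlongrightarrow> C * 0) at_top"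
    by (rule tendsto_mult[OF tendsto_const]) real_asymp
  then show "(F \<longlongrightarrow> 0) at_top"
    unfolding mult_zero_right by (rule Lim_null_comparison[OF always_eventually[OF allI[OF assms]]])
  have "((\<lambda>t::real. C * exp (- (1/2) * t\<^sup>2)) \<longlongrightarrow> C * 0) at_bot"
    by (rule tendsto_mult[OF tendsto_const]) real_asymp
  then show "(F \<longlongrightarrow> 0) at_bot"
    unfolding mult_zero_right by (rule Lim_null_comparison[OF always_eventually[OF allI[OF assms]]])
qed

text \<open>Integration by parts along the line \<open>t \<mapsto> s v + t u\<close>; with \<open>(u, v)\<close> equal to \<open>(1, \<i>)\<close> and
  \<open>(\<i>, 1)\<close> this covers both coordinate directions.\<close>

lemma gauss_line_integral_eq_0:
  fixes u v :: complex and s :: real and a b :: nat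
  defines "z \<equiv> \<lambda>t. of_real s * v + of_real t * u"
  assumes norm_z: "\<And>t. (norm (z t))\<^sup>2 = t\<^sup>2 + s\<^sup>2" and "norm u = 1"
  shows "(\<integral>t. exp (- (t\<^sup>2 + s\<^sup>2)) *\<^sub>R
    (of_nat a * z t ^ (a - 1) * u * cnj (z t) ^ b + of_nat b * z t ^ a * cnj (z t) ^ (b - 1) * cnj u
      - of_real (2 * t) * (z t ^ a * cnj (z t) ^ b)) \<partial>lborel) = 0"
proof -
  define F where "F t = exp (- (t\<^sup>2 + s\<^sup>2)) *\<^sub>R (z t ^ a * cnj (z t) ^ b)" for t
  define f where "f t = exp (- (t\<^sup>2 + s\<^sup>2)) *\<^sub>R
    (of_nat a * z t ^ (a - 1) * u * cnj (z t) ^ b + of_nat b * z t ^ a * cnj (z t) ^ (b - 1) * cnj u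
      - of_real (2 * t) * (z t ^ a * cnj (z t) ^ b))" for t
  have dz: "(z has_vector_derivative u) (at t)" for t
    unfolding z_def by (auto intro!: derivative_eq_intros)
  have dcz: "((\<lambda>t. cnj (z t)) has_vector_derivative cnj u) (at t)" for t
    by (intro has_vector_derivative_cnj dz)
  have dpow: "((\<lambda>t. w t ^ k) has_vector_derivative (of_nat k * w t ^ (k - 1) * w')) (at t)"
    if "(w has_vector_derivative w') (at t)" for w :: "real \<Rightarrow> complex" and w' t and k :: nat
  proof -
    have "((\<lambda>x. x ^ k) has_field_derivative (of_nat k * w t ^ (k - 1))) (at (w t))"
      by (auto intro!: derivative_eq_intros)
    from field_vector_diff_chain_at[OF that this] show ?thesis
      by (simp add: o_def mult_ac)
  qed
  have de: "((\<lambda>t. exp (- (t\<^sup>2 + s\<^sup>2))) has_vector_derivative (- 2 * t * exp (- (t\<^sup>2 + s\<^sup>2)))) (at t)" for t :: real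
    unfolding has_real_derivative_iff_has_vector_derivative[symmetric]
    by (auto intro!: derivative_eq_intros)
  have F': "(F has_vector_derivative f t) (at t)" for t
    unfolding F_def[abs_def]
    by (rule has_vector_derivative_eq_rhs[OF has_vector_derivative_scaleR[OF de[unfolded has_real_derivative_iff_has_vector_derivative[symmetric]] has_vector_derivative_mult[OF dpow[OF dz] dpow[OF dcz]]]])
       (simp add: f_def scaleR_conv_of_real algebra_simps)
  \<comment> \<open>Half of the exponent is spent on the power of \<open>norm (z t)\<close>, and the
    surviving factor depending on s is at most 1.\<close>
  have bound: "exp (- (t\<^sup>2 + s\<^sup>2)) * norm (z t) ^ n \<le> (1 + fact n / (1/2) ^ n) * exp (- (1/2) * t\<^sup>2)" for n t
  proof -
    have "exp (- (t\<^sup>2 + s\<^sup>2)) * norm (z t) ^ n \<le> exp (- (t\<^sup>2 + s\<^sup>2)) * ((1 + fact n / (1/2) ^ n) * exp (1/2 * (norm (z t))\<^sup>2))"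
      by (intro mult_left_mono power_le_exp_sq) auto
    also have "\<dots> = (1 + fact n / (1/2) ^ n) * exp (- (1/2) * (t\<^sup>2 + s\<^sup>2))"
    proof -
      have "exp (- (t\<^sup>2 + s\<^sup>2)) * exp (1/2 * (norm (z t))\<^sup>2) = exp (- (1/2) * (t\<^sup>2 + s\<^sup>2))"
        unfolding norm_z mult_exp_exp by (rule arg_cong[where f = exp]) (simp add: field_simps)
      then show ?thesis by (subst mult.left_commute) (simp only:)
    qed
    also have "\<dots> \<le> (1 + fact n / (1/2) ^ n) * exp (- (1/2) * t\<^sup>2)"
      by (intro mult_left_mono) auto
    finally show ?thesis .
  qed
  have F_bound: "norm (F t) \<le> (1 + fact (a + b) / (1/2) ^ (a + b)) * exp (- (1/2) * t\<^sup>2)" for t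
    using bound[of t "a + b"] by (simp add: F_def norm_mult norm_power power_add)
  \<comment> \<open>The factor 2 t from differentiating the weight can thus be counted as one more
    degree in \<open>norm (z t)\<close>, so \<open>bound\<close> also covers the last term of
    f.\<close>
  have t_le: "\<bar>t\<bar> \<le> norm (z t)" for t
    using norm_z[of t] by (metis abs_le_square_iff abs_norm_cancel le_add_same_cancel1 zero_le_power2)
  have f_bound: "norm (f t) \<le> (real a * (1 + fact (a - 1 + b) / (1/2) ^ (a - 1 + b))
      + real b * (1 + fact (a + (b - 1)) / (1/2) ^ (a + (b - 1)))
      + 2 * (1 + fact (a + b + 1) / (1/2) ^ (a + b + 1))) * exp (- (1/2) * t\<^sup>2)" for t
  proof -
    have "norm (f t) \<le> exp (- (t\<^sup>2 + s\<^sup>2)) * (real a * norm (z t) ^ (a - 1 + b) + real b * norm (z t) ^ (a + (b - 1))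
      + 2 * norm (z t) ^ (a + b + 1))"
      unfolding f_def norm_scaleR
    proof (intro mult_mono order_trans[OF norm_triangle_ineq4] order_trans[OF norm_triangle_ineq] add_mono)
      show "norm (of_real (2 * t) * (z t ^ a * cnj (z t) ^ b)) \<le> 2 * norm (z t) ^ (a + b + 1)"
        using t_le[of t] by (simp add: norm_mult norm_power power_add mult_right_mono)
    qed (simp_all add: norm_mult norm_power power_add \<open>norm u = 1\<close>)
    also have "\<dots> = real a * (exp (- (t\<^sup>2 + s\<^sup>2)) * norm (z t) ^ (a - 1 + b)) + real b * (exp (- (t\<^sup>2 + s\<^sup>2)) * norm (z t) ^ (a + (b - 1)))
      + 2 * (exp (- (t\<^sup>2 + s\<^sup>2)) * norm (z t) ^ (a + b + 1))"
      by (simp add: algebra_simps)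
    also have "\<dots> \<le> real a * ((1 + fact (a - 1 + b) / (1/2) ^ (a - 1 + b)) * exp (- (1/2) * t\<^sup>2))
      + real b * ((1 + fact (a + (b - 1)) / (1/2) ^ (a + (b - 1))) * exp (- (1/2) * t\<^sup>2))
      + 2 * ((1 + fact (a + b + 1) / (1/2) ^ (a + b + 1)) * exp (- (1/2) * t\<^sup>2))"
      by (intro add_mono mult_left_mono bound) auto
    finally show ?thesis by (simp add: algebra_simps)
  qed
  have cont: "continuous_on UNIV f"
    unfolding f_def z_def by (intro continuous_intros)
  have "integrable lborel f"
  proof (rule Bochner_Integration.integrable_bound)
    show "integrable lborel (\<lambda>t. (real a * (1 + fact (a - 1 + b) / (1/2) ^ (a - 1 + b))
      + real b * (1 + fact (a + (b - 1)) / (1/2) ^ (a + (b - 1)))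
      + 2 * (1 + fact (a + b + 1) / (1/2) ^ (a + b + 1))) * exp (- (1/2) * t\<^sup>2))"
      by (intro integrable_mult_right integrable_exp_neg_sq) simp
    show "f \<in> borel_measurable lborel"
      using borel_measurable_continuous_onI[OF cont] by simp
    show "AE t in lborel. norm (f t) \<le> norm ((real a * (1 + fact (a - 1 + b) / (1/2) ^ (a - 1 + b))
      + real b * (1 + fact (a + (b - 1)) / (1/2) ^ (a + (b - 1)))
      + 2 * (1 + fact (a + b + 1) / (1/2) ^ (a + b + 1))) * exp (- (1/2) * t\<^sup>2))"
      by (intro AE_I2 order_trans[OF f_bound]) (simp only: real_norm_def abs_ge_self)
  qed
  then have "integral\<^sup>L lborel f = 0"
    by (rule integral_deriv_eq_0[OF F' cont _ tendsto_0_of_exp_sq_bound[OF F_bound]])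
  then show ?thesis unfolding f_def .
qed

section \<open>Moments of the Gaussian\<close>

definition cmoment :: "nat \<Rightarrow> nat \<Rightarrow> complex"
  where "cmoment a b = (\<integral>z. z ^ a * cnj z ^ b \<partial>cgauss)"

lemma cmoment_integrable [simp]: "integrable cgauss (\<lambda>z. z ^ a * cnj z ^ b)"
  by (rule integrable_cgauss_poly[where B = 1 and n = "a + b"])
     (auto simp: norm_mult norm_power power_add intro!: borel_measurable_continuous_onI continuous_intros)

lemma cmoment_cnj: "cmoment b a = cnj (cmoment a b)"
  unfolding cmoment_def Bochner_Integration.integral_cnj[symmetric] by (simp add: mult.commute)

lemma cmoment_0: "cmoment 0 0 = pi"
proof -
  have one: "(\<integral>x. exp (- (x::real)\<^sup>2) \<partial>lborel) = sqrt pi"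
  proof -
    have "(\<integral>x. normal_density 0 (1 / sqrt 2) x \<partial>lborel) = 1"
      by (rule integral_normal_density) simp
    then show ?thesis
      by (simp add: normal_density_def power_divide real_sqrt_divide field_simps)
  qed
  have int: "integrable lborel (\<lambda>(x, y). exp (- x\<^sup>2) * exp (- (y::real)\<^sup>2))"
    using integrable_exp_neg_sq[of 1] by (intro integrable_lborel_prod) simp_all
  have "cmoment 0 0 = (\<integral>p. complex_of_real (case p of (x, y) \<Rightarrow> exp (- x\<^sup>2) * exp (- y\<^sup>2)) \<partial>lborel)"
  proof -
    have "(\<lambda>z::complex. z ^ 0 * cnj z ^ 0) \<in> borel_measurable borel" by simp
    then show ?thesis
      unfolding cmoment_def by (subst integral_cgauss, assumption)
        (rule Bochner_Integration.integral_cong, auto simp: mult_exp_exp scaleR_conv_of_real)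
  qed
  also have "\<dots> = of_real (\<integral>(x, y). exp (- x\<^sup>2) * exp (- y\<^sup>2) \<partial>lborel)"
    by (rule integral_complex_of_real)
  also have "(\<integral>(x, y). exp (- x\<^sup>2) * exp (- (y::real)\<^sup>2) \<partial>lborel) = pi"
    by (subst integral_lborel_fst[OF int]) (simp add: one)
  finally show ?thesis .
qed

text \<open>Integration by parts for the Wirtinger derivative in cnj z, under which the weight exp
  (-|z|^2) picks up the factor -z. It is assembled from the directional derivatives along 1 and
  \<i>.\<close>

lemma cmoment_Suc: "cmoment (Suc a) b = of_nat b * cmoment a (b - 1)"
proof -
  \<comment> \<open>Up to the weight, this is the derivative along u of z^a * cnj z^b times the
    Gaussian; \<open>Re (cnj u * z)\<close> is the coordinate of z along the unit vector u.\<close>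
  define h where "h u z = of_nat a * (z ^ (a - 1) * cnj z ^ b) * u + of_nat b * (z ^ a * cnj z ^ (b - 1)) * cnj u
      - of_real (2 * Re (cnj u * z)) * (z ^ a * cnj z ^ b)" for u z :: complex
  have h_cont: "continuous_on UNIV (h u)" for u
    unfolding h_def by (intro continuous_intros)
  note [measurable] = borel_measurable_continuous_onI[OF h_cont]
  have re: "of_real (2 * Re w) = w + cnj w" for w by (simp add: complex_add_cnj)
  have h_eq: "h u z = of_nat a * (z ^ (a - 1) * cnj z ^ b) * u + of_nat b * (z ^ a * cnj z ^ (b - 1)) * cnj u
      - (cnj u * (z ^ Suc a * cnj z ^ b) + u * (z ^ a * cnj z ^ Suc b))" for u z
    unfolding h_def re by (simp add: algebra_simps)
  have h_int: "integrable cgauss (h u)" for u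
    unfolding h_eq by (intro Bochner_Integration.integrable_diff Bochner_Integration.integrable_add
       integrable_mult_right integrable_mult_left cmoment_integrable)
  have h1: "integral\<^sup>L cgauss (h 1) = 0"
  proof -
    have "integral\<^sup>L cgauss (h 1) = (\<integral>y. \<integral>x. exp (- (x\<^sup>2 + y\<^sup>2)) *\<^sub>R h 1 (Complex x y) \<partial>lborel \<partial>lborel)"
      using h_int[of 1] by (subst integral_cgauss) (simp_all add: integrable_cgauss_iff integral_lborel_snd)
    also have "(\<lambda>y. \<integral>x. exp (- (x\<^sup>2 + y\<^sup>2)) *\<^sub>R h 1 (Complex x y) \<partial>lborel) = (\<lambda>y. 0)"
    proof (rule ext)
      fix y :: real
      have *: "of_real y * \<i> + of_real x * 1 = Complex x y" for x
        by (simp add: Complex_eq)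
      show "(\<integral>x. exp (- (x\<^sup>2 + y\<^sup>2)) *\<^sub>R h 1 (Complex x y) \<partial>lborel) = 0"
        using gauss_line_integral_eq_0[of y \<i> 1 a b] unfolding * h_def
        by (simp add: cmod_power2 mult_ac)
    qed
    finally show ?thesis by simp
  qed
  have h2: "integral\<^sup>L cgauss (h \<i>) = 0"
  proof -
    have "integral\<^sup>L cgauss (h \<i>) = (\<integral>x. \<integral>y. exp (- (x\<^sup>2 + y\<^sup>2)) *\<^sub>R h \<i> (Complex x y) \<partial>lborel \<partial>lborel)"
      using h_int[of \<i>] by (subst integral_cgauss) (simp_all add: integrable_cgauss_iff integral_lborel_fst)
    also have "(\<lambda>x. \<integral>y. exp (- (x\<^sup>2 + y\<^sup>2)) *\<^sub>R h \<i> (Complex x y) \<partial>lborel) = (\<lambda>x. 0)"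
    proof (rule ext)
      fix x :: real
      have *: "of_real x * 1 + of_real y * \<i> = Complex x y" for y
        by (simp add: Complex_eq)
      show "(\<integral>y. exp (- (x\<^sup>2 + y\<^sup>2)) *\<^sub>R h \<i> (Complex x y) \<partial>lborel) = 0"
        using gauss_line_integral_eq_0[of x 1 \<i> a b] unfolding * h_def
        by (simp add: cmod_power2 mult_ac add.commute)
    qed
    finally show ?thesis by simp
  qed
  have "integral\<^sup>L cgauss (h u) = of_nat a * cmoment (a - 1) b * u + of_nat b * cmoment a (b - 1) * cnj u
      - (cnj u * cmoment (Suc a) b + u * cmoment a (Suc b))" for u
    unfolding h_eq cmoment_def
    by (simp add: Bochner_Integration.integral_diff Bochner_Integration.integral_add del: power_Suc)
  \<comment> \<open>Direction 1 gives the sum of the two one-step relations and direction \<i> their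
    difference; subtracting isolates the wanted one, doubled.\<close>
  from this[of 1] this[of \<i>] h1 h2
  have "of_nat a * cmoment (a - 1) b + of_nat b * cmoment a (b - 1) = cmoment (Suc a) b + cmoment a (Suc b)"
    "\<i> * (of_nat a * cmoment (a - 1) b - of_nat b * cmoment a (b - 1)) = \<i> * (cmoment a (Suc b) - cmoment (Suc a) b)"
    by (simp_all add: algebra_simps)
  then have "of_nat a * cmoment (a - 1) b + of_nat b * cmoment a (b - 1) = cmoment (Suc a) b + cmoment a (Suc b)"
    "of_nat a * cmoment (a - 1) b - of_nat b * cmoment a (b - 1) = cmoment a (Suc b) - cmoment (Suc a) b"
    by simp_all
  then have "2 * (of_nat b * cmoment a (b - 1)) = 2 * cmoment (Suc a) b"
    by algebra
  then show ?thesis by simp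
qed

lemma cmoment_eq: "cmoment a b = (if a = b then of_real (pi * fact a) else 0)"
proof (induction a arbitrary: b)
  case 0
  show ?case
  proof (cases b)
    case (Suc k)
    then show ?thesis by (simp add: cmoment_cnj[of 0] cmoment_Suc)
  qed (simp add: cmoment_0)
next
  case (Suc a)
  then show ?case by (cases b) (simp_all add: cmoment_Suc)
qed

section \<open>Orthogonality of the Hermite polynomials\<close>

lemma integrable_monomial_hermite [simp]:
  "integrable cgauss (\<lambda>z. (cnj z ^ a * z ^ b) * hermite m n z)"
proof -
  have "(\<lambda>z. (cnj z ^ a * z ^ b) * hermite m n z) = (\<lambda>z. \<Sum>j\<le>min m n.
      of_real ((- 1) ^ j * fact j * real (m choose j) * real (n choose j)) * (z ^ (b + (m - j)) * cnj z ^ (a + (n - j))))"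
    unfolding hermite_def sum_distrib_left power_add by (intro ext sum.cong refl) (simp only: mult_ac)
  then show ?thesis
    by (simp only:) (intro Bochner_Integration.integrable_sum integrable_mult_right cmoment_integrable)
qed

text \<open>The recurrence trades one unit of m for one more in b or one less in n, so n and b must
  stay free in the induction while a is fixed.\<close>

lemma integral_monomial_hermite:
  "(\<integral>z. (cnj z ^ a * z ^ b) * hermite m n z \<partial>cgauss)
    = (if a + n = b + m \<and> m \<le> a then of_real (pi * fact a * fact b / fact (a - m)) else 0)"
proof (induction m arbitrary: n b)
  case 0
  have "(\<integral>z. (cnj z ^ a * z ^ b) * hermite 0 n z \<partial>cgauss) = cmoment b (a + n)"
    unfolding cmoment_def by (simp add: power_add mult_ac)
  then show ?case by (auto simp: cmoment_eq)
next
  case (Suc m)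
  have "(\<lambda>z. (cnj z ^ a * z ^ b) * hermite (Suc m) n z) = (\<lambda>z. (cnj z ^ a * z ^ Suc b) * hermite m n z
    - of_nat n * ((cnj z ^ a * z ^ b) * hermite m (n - 1) z))"
    by (simp add: hermite_Suc_left algebra_simps fun_eq_iff)
  then have eq: "(\<integral>z. (cnj z ^ a * z ^ b) * hermite (Suc m) n z \<partial>cgauss) =
     (\<integral>z. (cnj z ^ a * z ^ Suc b) * hermite m n z \<partial>cgauss) - of_nat n * (\<integral>z. (cnj z ^ a * z ^ b) * hermite m (n - 1) z \<partial>cgauss)"
    by (simp only: Bochner_Integration.integral_diff integrable_monomial_hermite integrable_mult_right integral_mult_right_zero)
  show ?case
  proof (cases "a + n = b + Suc m \<and> m \<le> a")
    case False
    \<comment> \<open>For n = 0 the truncated n - 1 could satisfy the index condition, but then the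
      factor n is 0.\<close>
    then have z0: "of_nat n * (\<integral>z. (cnj z ^ a * z ^ b) * hermite m (n - 1) z \<partial>cgauss) = 0"
      unfolding Suc.IH by (cases n) auto
    show ?thesis
      unfolding eq unfolding z0 unfolding Suc.IH using False by auto
  next
    case True
    \<comment> \<open>With k = a - m and b + 1 = k + n, the two contributions differ by the factor
      (b + 1) - n = k, which lowers k! to (k-1)!. For k = 0 the result vanishes, as it must because
      then \<open>Suc m\<close> exceeds a.\<close>
    then obtain k where a: "a = m + k" using le_Suc_ex by auto
    with True have b: "Suc b = k + n" by simp
    have n': "of_nat n * (\<integral>z. (cnj z ^ a * z ^ b) * hermite m (n - 1) z \<partial>cgauss)
       = of_nat n * of_real (pi * fact a * fact b / fact k)"
      unfolding Suc.IH using a b by (cases n) auto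
    have "(\<integral>z. (cnj z ^ a * z ^ b) * hermite (Suc m) n z \<partial>cgauss)
       = of_real (pi * fact a * fact (Suc b) / fact k) - of_nat n * of_real (pi * fact a * fact b / fact k)"
      unfolding eq n' unfolding Suc.IH using a b by simp
    also have "\<dots> = of_real (pi * fact a * fact b / fact k * (real (Suc b) - real n))"
      by (simp add: algebra_simps diff_divide_distrib add_divide_distrib)
    also have "real (Suc b) - real n = real k" using b by simp
    also have "pi * fact a * fact b / fact k * real k = (if k = 0 then 0 else pi * fact a * fact b / fact (k - 1))"
      by (cases k) (simp_all add: fact_reduce[of "Suc _"] del: fact_Suc of_nat_Suc)
    finally show ?thesis using a b by (cases k) auto
  qed
qed

lemma cnj_hermite_mult_eq_sum:
  "(\<lambda>z. cnj (hermite a b z) * hermite m n z) = (\<lambda>z. \<Sum>j\<le>min a b.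
    of_real ((- 1) ^ j * fact j * real (a choose j) * real (b choose j)) *
    ((cnj z ^ (a - j) * z ^ (b - j)) * hermite m n z))"
  unfolding hermite_def[of a b] cnj_sum sum_distrib_right
  by (intro ext sum.cong refl)
    (simp only: complex_cnj_mult complex_cnj_power complex_cnj_cnj complex_cnj_complex_of_real mult_ac)

lemma integrable_hermite_inner: "integrable cgauss (\<lambda>z. cnj (hermite a b z) * hermite m n z)"
  unfolding cnj_hermite_mult_eq_sum
  by (intro Bochner_Integration.integrable_sum integrable_mult_right integrable_monomial_hermite)

text \<open>If a < m or b < n, each monomial of the conjugated factor fails the condition in
  \<open>integral_monomial_hermite\<close>; conjugation gives the two opposite inequalities. On the
  diagonal only the leading monomial j = 0 passes the condition.\<close>

lemma hermite_inner:
  "(\<integral>z. cnj (hermite a b z) * hermite m n z \<partial>cgauss)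
    = (if a = m \<and> b = n then of_real (pi * fact m * fact n) else 0)"
proof -
  have expand: "(\<integral>z. cnj (hermite a b z) * hermite m n z \<partial>cgauss) = (\<Sum>j\<le>min a b.
      of_real ((- 1) ^ j * fact j * real (a choose j) * real (b choose j)) *
      (\<integral>z. (cnj z ^ (a - j) * z ^ (b - j)) * hermite m n z \<partial>cgauss))" for a b m n
    unfolding cnj_hermite_mult_eq_sum
    by (simp only: Bochner_Integration.integral_sum integrable_monomial_hermite
        integrable_mult_right integral_mult_right_zero)
  have zero: "(\<integral>z. cnj (hermite a b z) * hermite m n z \<partial>cgauss) = 0" if "a < m \<or> b < n" for a b m n
    unfolding expand integral_monomial_hermite using that by (intro sum.neutral) auto
  show ?thesis
  proof (cases "a < m \<or> b < n \<or> m < a \<or> n < b")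
    case True
    have "(\<integral>z. cnj (hermite a b z) * hermite m n z \<partial>cgauss) = cnj (\<integral>z. cnj (hermite m n z) * hermite a b z \<partial>cgauss)"
      unfolding Bochner_Integration.integral_cnj[symmetric] by (simp add: mult.commute)
    with True zero[of a m b n] zero[of m a n b] show ?thesis by auto
  next
    case False
    then have ab: "a = m" "b = n" by auto
    have "(\<integral>z. cnj (hermite m n z) * hermite m n z \<partial>cgauss) = (\<Sum>j\<in>{0}.
      of_real ((- 1) ^ j * fact j * real (m choose j) * real (n choose j)) *
      (\<integral>z. (cnj z ^ (m - j) * z ^ (n - j)) * hermite m n z \<partial>cgauss))"
      unfolding expand by (rule sum.mono_neutral_right) (auto simp: integral_monomial_hermite)
    then show ?thesis by (simp add: ab integral_monomial_hermite)
  qed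
qed

section \<open>Functions of exponential decay are determined by their moments\<close>

lemma sum_norm_exp_series_le: "(\<Sum>k<n. norm (z ^ k /\<^sub>R fact k)) \<le> exp (norm z)" for z :: complex
proof -
  have "(\<Sum>k<n. norm (z ^ k /\<^sub>R fact k)) = (\<Sum>k<n. norm z ^ k /\<^sub>R fact k)"
    by (simp add: norm_power divide_inverse)
  also have "\<dots> \<le> (\<Sum>k. norm z ^ k /\<^sub>R fact k)"
    by (intro sum_le_suminf summable_exp_generic) auto
  finally show ?thesis by (simp add: exp_def)
qed

text \<open>Exponential integrability lets the power series of \<open>iexp\<close> be integrated
  term by term, so vanishing moments kill the Fourier transform. Levy's theorem compares probability
  measures, hence the split of the signed g into positive and negative parts.\<close>

lemma moments_eq_0_imp_AE_eq_0:
  fixes g :: "real \<Rightarrow> real"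
  assumes g [measurable]: "g \<in> borel_measurable borel"
    and int: "\<And>t. integrable lborel (\<lambda>x. g x * exp (t * \<bar>x\<bar>))"
    and mom: "\<And>n. (\<integral>x. g x * x ^ n \<partial>lborel) = 0"
  shows "AE x in lborel. g x = 0"
proof -
  have g_int: "integrable lborel g" using int[of 0] by simp
  have pow_int: "integrable lborel (\<lambda>x. g x * x ^ n)" for n
  proof (rule Bochner_Integration.integrable_bound)
    show "integrable lborel (\<lambda>x. fact n * (g x * exp (1 * \<bar>x\<bar>)))"
      by (intro integrable_mult_right int)
    show "AE x in lborel. norm (g x * x ^ n) \<le> norm (fact n * (g x * exp (1 * \<bar>x\<bar>)))"
    proof (rule AE_I2)
      fix x :: real
      have "\<bar>x\<bar> ^ n \<le> fact n * exp \<bar>x\<bar>"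
        using power_over_fact_le_exp[of "\<bar>x\<bar>" n] by (simp add: field_simps)
      then have "\<bar>g x\<bar> * \<bar>x\<bar> ^ n \<le> \<bar>g x\<bar> * (fact n * exp \<bar>x\<bar>)"
        by (intro mult_left_mono) auto
      then show "norm (g x * x ^ n) \<le> norm (fact n * (g x * exp (1 * \<bar>x\<bar>)))"
        by (simp add: abs_mult power_abs mult_ac)
    qed
  qed measurable
  have iexp_int: "integrable lborel (\<lambda>x. f x *\<^sub>R iexp (t * x))"
    if "integrable lborel f" for f :: "real \<Rightarrow> real" and t
    using that by (rule Bochner_Integration.integrable_bound) (use that in auto)
  have fourier: "(\<integral>x. g x *\<^sub>R iexp (t * x) \<partial>lborel) = 0" for t
  proof -
    define z where "z x = \<i> * of_real (t * x)" for x
    have "(\<lambda>N. \<integral>x. g x *\<^sub>R (\<Sum>n<N. z x ^ n /\<^sub>R fact n) \<partial>lborel) \<longlonglongrightarrow> (\<integral>x. g x *\<^sub>R iexp (t * x) \<partial>lborel)"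
    proof (rule integral_dominated_convergence[where w = "\<lambda>x. \<bar>g x * exp (\<bar>t\<bar> * \<bar>x\<bar>)\<bar>"])
      show "AE x in lborel. (\<lambda>N. g x *\<^sub>R (\<Sum>n<N. z x ^ n /\<^sub>R fact n)) \<longlonglongrightarrow> g x *\<^sub>R iexp (t * x)"
        unfolding z_def by (intro AE_I2 tendsto_scaleR tendsto_const exp_converges[unfolded sums_def])
      show "AE x in lborel. norm (g x *\<^sub>R (\<Sum>n<N. z x ^ n /\<^sub>R fact n)) \<le> \<bar>g x * exp (\<bar>t\<bar> * \<bar>x\<bar>)\<bar>" for N
      proof (rule AE_I2)
        fix x :: real
        have "norm (\<Sum>n<N. z x ^ n /\<^sub>R fact n) \<le> (\<Sum>n<N. norm (z x ^ n /\<^sub>R fact n))"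
          by (rule norm_sum)
        also have "\<dots> \<le> exp (norm (z x))"
          by (rule sum_norm_exp_series_le)
        also have "norm (z x) = \<bar>t\<bar> * \<bar>x\<bar>"
          by (simp add: z_def norm_mult)
        finally show "norm (g x *\<^sub>R (\<Sum>n<N. z x ^ n /\<^sub>R fact n)) \<le> \<bar>g x * exp (\<bar>t\<bar> * \<bar>x\<bar>)\<bar>"
          by (simp add: abs_mult mult_left_mono)
      qed
    qed (auto intro: int simp: z_def)
    moreover have "(\<integral>x. g x *\<^sub>R (\<Sum>n<N. z x ^ n /\<^sub>R fact n) \<partial>lborel) = 0" for N
    proof -
      have "(\<lambda>x. g x *\<^sub>R (\<Sum>n<N. z x ^ n /\<^sub>R fact n)) =
          (\<lambda>x. \<Sum>n<N. of_real (g x * x ^ n) * ((\<i> * of_real t) ^ n /\<^sub>R fact n))"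
        by (simp add: z_def sum_distrib_left power_mult_distrib scaleR_conv_of_real mult_ac)
      then have "(\<integral>x. g x *\<^sub>R (\<Sum>n<N. z x ^ n /\<^sub>R fact n) \<partial>lborel) =
          (\<Sum>n<N. (\<integral>x. complex_of_real (g x * x ^ n) \<partial>lborel) * ((\<i> * of_real t) ^ n /\<^sub>R fact n))"
        by (simp only:) (subst Bochner_Integration.integral_sum,
            intro integrable_mult_left integrable_of_real pow_int, simp only: integral_mult_left_zero)
      also have "\<dots> = 0"
        by (simp only: integral_complex_of_real mom) simp
      finally show ?thesis .
    qed
    ultimately show ?thesis by (simp add: LIMSEQ_const_iff)
  qed
  define p where "p x = max 0 (g x)" for x
  define q where "q x = max 0 (- g x)" for x
  have [measurable]: "p \<in> borel_measurable borel" "q \<in> borel_measurable borel"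
    unfolding p_def q_def by measurable
  have p_int: "integrable lborel p" and q_int: "integrable lborel q"
    using g_int unfolding p_def[abs_def] q_def[abs_def] by (auto intro!: integrable_max)
  have pq: "p x \<ge> 0" "q x \<ge> 0" for x by (auto simp: p_def q_def)
  have g_eq: "g x = p x - q x" for x by (auto simp: p_def q_def)
  \<comment> \<open>The zeroth moment forces both parts to have the same mass, so one constant
    normalises both; mass 0 admits no normalisation and is treated separately.\<close>
  define m where "m = integral\<^sup>L lborel p"
  have m: "m = integral\<^sup>L lborel q"
    using mom[of 0] p_int q_int by (simp add: g_eq m_def)
  have "AE x in lborel. p x = q x"
  proof (cases "m = 0")
    case True
    then have "integral\<^sup>L lborel p = 0" "integral\<^sup>L lborel q = 0"
      using m by (simp_all add: m_def)
    then have "AE x in lborel. p x = 0" "AE x in lborel. q x = 0"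
      using p_int q_int by (simp_all add: integral_nonneg_eq_0_iff_AE pq)
    then show ?thesis by eventually_elim simp
  next
    case False
    then have "m > 0" by (simp add: m_def p_def order_less_le)
    define D where "D f = density lborel (\<lambda>x. ennreal (f x / m))" for f :: "real \<Rightarrow> real"
    have D: "real_distribution (D f)" if [measurable]: "f \<in> borel_measurable borel"
      and "\<And>x. f x \<ge> 0" "integrable lborel f" "integral\<^sup>L lborel f = m" for f
    proof -
      have "emeasure (D f) (space (D f)) = (\<integral>\<^sup>+x. ennreal (f x / m) \<partial>lborel)"
        by (simp add: D_def emeasure_density)
      also have "\<dots> = ennreal (\<integral>x. f x / m \<partial>lborel)"
        using that \<open>m > 0\<close> by (intro nn_integral_eq_integral) auto
      also have "\<dots> = 1" using that \<open>m > 0\<close> by simp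
      finally have "prob_space (D f)" by (rule prob_spaceI)
      then show ?thesis
        by (auto simp: real_distribution_def real_distribution_axioms_def D_def)
    qed
    have char_D: "char (D f) t = (\<integral>x. f x *\<^sub>R iexp (t * x) \<partial>lborel) / of_real m"
      if [measurable]: "f \<in> borel_measurable borel" and "\<And>x. f x \<ge> 0" for f t
      unfolding char_def D_def using that \<open>m > 0\<close>
      by (subst integral_density) (auto simp: scaleR_conv_of_real divide_inverse mult_ac simp flip: of_real_inverse)
    have "(\<integral>x. p x *\<^sub>R iexp (t * x) \<partial>lborel) - (\<integral>x. q x *\<^sub>R iexp (t * x) \<partial>lborel) = 0" for t
      using fourier[of t] iexp_int[OF p_int, of t] iexp_int[OF q_int, of t] by (simp add: g_eq scaleR_left_diff_distrib)
    then have "char (D p) = char (D q)"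
      by (intro ext) (simp add: char_D pq)
    then have "D p = D q"
      using pq p_int q_int m by (intro Levy_uniqueness D) (auto simp: m_def)
    then have "AE x in lborel. ennreal (p x / m) = ennreal (q x / m)"
      unfolding D_def by (intro sigma_finite_measure.density_unique[OF sigma_finite_lborel]) measurable
    then show ?thesis
      by eventually_elim (use pq \<open>m > 0\<close> in auto)
  qed
  then show ?thesis by eventually_elim (simp add: g_eq)
qed

text \<open>The partial moments in y are functions of x with vanishing moments, hence zero almost
  everywhere. Countably many null sets can be discarded together, after which almost every section
  of g satisfies the one-variable hypotheses.\<close>

lemma moments_eq_0_imp_AE_eq_0_prod:
  fixes g :: "real \<times> real \<Rightarrow> real"
  assumes g [measurable]: "g \<in> borel_measurable borel"
    and int: "\<And>t. integrable lborel (\<lambda>(x, y). g (x, y) * exp (t * (\<bar>x\<bar> + \<bar>y\<bar>)))"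
    and mom: "\<And>a b. (\<integral>(x, y). g (x, y) * (x ^ a * y ^ b) \<partial>lborel) = 0"
  shows "AE p in lborel. g p = 0"
proof -
  have [measurable]: "g \<in> borel_measurable (lborel \<Otimes>\<^sub>M lborel)"
    using g by (simp add: lborel_prod)
  have gint: "integrable (lborel \<Otimes>\<^sub>M lborel) (\<lambda>(x, y). g (x, y) * q x y)"
    if [measurable]: "(\<lambda>(x, y). q x y) \<in> borel_measurable (lborel \<Otimes>\<^sub>M lborel)"
      and q: "\<And>x y. \<bar>q x y\<bar> \<le> C * exp (t * (\<bar>x\<bar> + \<bar>y\<bar>))" for q C t
  proof (rule Bochner_Integration.integrable_bound)
    show "integrable (lborel \<Otimes>\<^sub>M lborel) (\<lambda>p. C * (case p of (x, y) \<Rightarrow> g (x, y) * exp (t * (\<bar>x\<bar> + \<bar>y\<bar>))))"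
      using int[of t] by (simp add: lborel_prod)
    show "AE p in lborel \<Otimes>\<^sub>M lborel. norm (case p of (x, y) \<Rightarrow> g (x, y) * q x y)
      \<le> norm (C * (case p of (x, y) \<Rightarrow> g (x, y) * exp (t * (\<bar>x\<bar> + \<bar>y\<bar>))))"
    proof (rule AE_I2, clarify)
      fix x y
      have "\<bar>g (x, y)\<bar> * \<bar>q x y\<bar> \<le> \<bar>g (x, y)\<bar> * \<bar>C * exp (t * (\<bar>x\<bar> + \<bar>y\<bar>))\<bar>"
        by (intro mult_left_mono order_trans[OF q] abs_ge_self) simp
      then show "norm (g (x, y) * q x y) \<le> norm (C * (g (x, y) * exp (t * (\<bar>x\<bar> + \<bar>y\<bar>))))"
        by (simp add: abs_mult mult_ac)
    qed
  qed measurable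
  have pow: "\<bar>y\<bar> ^ b \<le> fact b * exp \<bar>y\<bar>" for y :: real and b
    using power_over_fact_le_exp[of "\<bar>y\<bar>" b] by (simp add: field_simps)
  \<comment> \<open>The power of y costs exponent 1 and the exponential in x costs t, possibly
    negative; \<open>max 1 t\<close> covers both.\<close>
  have pow_exp: "\<bar>y ^ b * exp (t * \<bar>x\<bar>)\<bar> \<le> fact b * exp (max 1 t * (\<bar>x\<bar> + \<bar>y\<bar>))" for x y t :: real and b
  proof -
    have "\<bar>y ^ b * exp (t * \<bar>x\<bar>)\<bar> = \<bar>y\<bar> ^ b * exp (t * \<bar>x\<bar>)"
      by (simp add: abs_mult power_abs)
    also have "\<dots> \<le> fact b * exp \<bar>y\<bar> * exp (t * \<bar>x\<bar>)"
      by (intro mult_right_mono pow) simp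
    also have "\<dots> = fact b * exp (1 * \<bar>y\<bar> + t * \<bar>x\<bar>)"
      by (simp add: exp_add)
    also have "\<dots> \<le> fact b * exp (max 1 t * \<bar>y\<bar> + max 1 t * \<bar>x\<bar>)"
      by (intro mult_left_mono exp_le_cancel_iff[THEN iffD2] add_mono mult_right_mono) auto
    finally show ?thesis by (simp add: algebra_simps)
  qed
  define h where "h b x = (\<integral>y. g (x, y) * y ^ b \<partial>lborel)" for b x
  have h_0: "AE x in lborel. h b x = 0" for b
  proof (rule moments_eq_0_imp_AE_eq_0)
    show "h b \<in> borel_measurable borel"
      unfolding h_def by measurable
    show "integrable lborel (\<lambda>x. h b x * exp (t * \<bar>x\<bar>))" for t
    proof -
      have "integrable (lborel \<Otimes>\<^sub>M lborel) (\<lambda>(x, y). g (x, y) * (y ^ b * exp (t * \<bar>x\<bar>)))"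
        by (rule gint[OF _ pow_exp]) measurable
      from lborel_pair.integrable_fst[OF this] show ?thesis
        by (simp add: h_def mult.assoc[symmetric])
    qed
    show "(\<integral>x. h b x * x ^ a \<partial>lborel) = 0" for a
    proof -
      have "integrable (lborel \<Otimes>\<^sub>M lborel) (\<lambda>(x, y). g (x, y) * (y ^ b * x ^ a))"
      proof (rule gint)
        fix x y :: real
        have "\<bar>y ^ b * x ^ a\<bar> \<le> (fact b * exp \<bar>y\<bar>) * (fact a * exp \<bar>x\<bar>)"
          unfolding abs_mult power_abs by (intro mult_mono pow) auto
        then show "\<bar>y ^ b * x ^ a\<bar> \<le> (fact b * fact a) * exp (1 * (\<bar>x\<bar> + \<bar>y\<bar>))"
          by (simp add: exp_add mult_ac)
      qed measurable
      from lborel_pair.integral_fst[OF this]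
      have "(\<integral>x. \<integral>y. g (x, y) * y ^ b * x ^ a \<partial>lborel \<partial>lborel) = (\<integral>(x, y). g (x, y) * (x ^ a * y ^ b) \<partial>lborel)"
        by (simp add: lborel_prod mult_ac)
      then show ?thesis by (simp add: h_def mom)
    qed
  qed
  have "AE x in lborel. \<forall>b. h b x = 0"
    by (simp add: AE_all_countable h_0)
  \<comment> \<open>Only natural exponents k are used, so that the exceptional sets remain
    countable; a real exponent t is dominated by some k \<ge> t.\<close>
  moreover have "AE x in lborel. integrable lborel (\<lambda>y. g (x, y) * exp (real k * \<bar>y\<bar>))" for k :: nat
  proof -
    have "integrable (lborel \<Otimes>\<^sub>M lborel) (\<lambda>(x, y). g (x, y) * exp (real k * \<bar>y\<bar>))"
      by (rule gint[where C = 1 and t = "real k"]) (measurable, simp add: mult_left_mono)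
    from lborel_pair.AE_integrable_fst[OF this] show ?thesis .
  qed
  then have "AE x in lborel. \<forall>k::nat. integrable lborel (\<lambda>y. g (x, y) * exp (real k * \<bar>y\<bar>))"
    by (simp add: AE_all_countable)
  ultimately have "AE x in lborel. AE y in lborel. g (x, y) = 0"
  proof eventually_elim
    case (elim x)
    show ?case
    proof (rule moments_eq_0_imp_AE_eq_0)
      show "(\<lambda>y. g (x, y)) \<in> borel_measurable borel" by measurable
      show "integrable lborel (\<lambda>y. g (x, y) * exp (t * \<bar>y\<bar>))" for t
      proof -
        obtain k :: nat where k: "t \<le> real k" using real_arch_simple by blast
        have "integrable lborel (\<lambda>y. g (x, y) * exp (real k * \<bar>y\<bar>))" using elim by blast
        then show ?thesis
        proof (rule Bochner_Integration.integrable_bound)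
          show "AE y in lborel. norm (g (x, y) * exp (t * \<bar>y\<bar>)) \<le> norm (g (x, y) * exp (real k * \<bar>y\<bar>))"
            using k by (auto simp: abs_mult intro!: AE_I2 mult_left_mono mult_right_mono)
        qed measurable
      qed
      show "(\<integral>y. g (x, y) * y ^ n \<partial>lborel) = 0" for n
        using elim by (simp add: h_def)
    qed
  qed
  then have "AE p in lborel \<Otimes>\<^sub>M lborel. g p = 0"
    by (intro lborel_pair.AE_pair_measure) measurable
  then show ?thesis unfolding lborel_prod .
qed

section \<open>Hermite polynomials on a slice\<close>

lemma HQ_eq_sum: "HQ m n q = (\<Sum>j\<le>min m n. ((- 1) ^ j * fact j * real (m choose j) * real (n choose j))
    *\<^sub>R (q ^ (m - j) * qcnj q ^ (n - j)))"
proof -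
  have "fact m * fact n * ((- 1) ^ j / fact j) * inverse (fact (m - j) * fact (n - j))
      = (- 1) ^ j * fact j * real (m choose j) * real (n choose j)" if "j \<le> min m n" for j
    using that by (simp add: binomial_fact field_simps)
  then show ?thesis
    unfolding HQ_def scaleR_sum_right scaleR_scaleR
    by (intro sum.cong refl arg_cong2[where f = scaleR]) (simp add: mult_ac)
qed

text \<open>For fixed k the growth in j is geometric: the summation index is at most k, so its
  factorial is bounded by k!, and the binomial in j contributes at most 2^j.\<close>

lemma norm_HQ_le:
  assumes "norm q \<le> R" "1 \<le> R"
  shows "norm (HQ j k q) \<le> real (Suc k) * (fact k * 2 ^ k * R ^ k) * (2 * R) ^ j"
proof -
  have "norm (HQ j k q) \<le> (\<Sum>i\<le>min j k. fact k * 2 ^ k * R ^ k * (2 * R) ^ j)"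
    unfolding HQ_eq_sum
  proof (intro sum_norm_le)
    fix i assume i: "i \<in> {..min j k}"
    have "real (j choose i) \<le> 2 ^ j" "real (k choose i) \<le> 2 ^ k"
      using binomial_le_pow2[of j i] binomial_le_pow2[of k i]
      by (metis of_nat_le_iff of_nat_numeral of_nat_power)+
    moreover have "norm q ^ (l - i) \<le> R ^ l" for l
    proof -
      have "norm q ^ (l - i) \<le> R ^ (l - i)" using assms by (intro power_mono) auto
      also have "\<dots> \<le> R ^ l" using assms by (intro power_increasing) auto
      finally show ?thesis .
    qed
    moreover have "(fact i :: real) \<le> fact k" using i by (intro fact_mono) auto
    ultimately have "fact i * real (j choose i) * real (k choose i) * (norm q ^ (j - i) * norm q ^ (k - i))
        \<le> fact k * 2 ^ j * 2 ^ k * (R ^ j * R ^ k)"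
      using assms by (intro mult_mono) auto
    then show "norm (((- 1) ^ i * fact i * real (j choose i) * real (k choose i)) *\<^sub>R (q ^ (j - i) * qcnj q ^ (k - i)))
        \<le> fact k * 2 ^ k * R ^ k * (2 * R) ^ j"
      by (simp add: norm_mult_quat norm_power_quat abs_mult power_abs power_mult_distrib mult_ac)
  qed
  also have "\<dots> = real (Suc (min j k)) * (fact k * 2 ^ k * R ^ k * (2 * R) ^ j)" by simp
  also have "\<dots> \<le> real (Suc k) * (fact k * 2 ^ k * R ^ k * (2 * R) ^ j)"
    using assms by (intro mult_right_mono) auto
  finally show ?thesis by (simp add: mult_ac)
qed

text \<open>Each term is split as (\<open>norm (HQ j k q)\<close> / sqrt (j!)) * (sqrt (j!) *
  \<open>norm (c j)\<close>). The product is bounded by the sum of squares, where an exponential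
  series dominates the first squares and the hypothesis handles the second.\<close>

lemma summable_HQ_mult:
  assumes "summable (\<lambda>j. fact j * (norm (c j :: quat))\<^sup>2)"
  shows "summable (\<lambda>j. HQ j k q * c j)"
proof (rule summable_norm_cancel, rule summable_comparison_test')
  define R where "R = max 1 (norm q)"
  define r where "r = 2 * R"
  define C where "C = real (Suc k) * (fact k * 2 ^ k * R ^ k)"
  have R: "1 \<le> R" "norm q \<le> R" by (auto simp: R_def)
  have nonneg: "0 \<le> C" "0 \<le> r" using R by (auto simp: C_def r_def)
  have "summable (\<lambda>j. C\<^sup>2 * ((r\<^sup>2) ^ j /\<^sub>R fact j))"
    by (intro summable_mult summable_exp_generic)
  then show "summable (\<lambda>j. C\<^sup>2 * ((r\<^sup>2) ^ j /\<^sub>R fact j) + fact j * (norm (c j))\<^sup>2)"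
    by (intro summable_add assms)
  fix j
  have "norm (norm (HQ j k q * c j)) = norm (HQ j k q) * norm (c j)"
    by (simp add: norm_mult_quat)
  also have "\<dots> \<le> C * r ^ j * norm (c j)"
    unfolding C_def r_def by (intro mult_right_mono norm_HQ_le R) simp
  also have "\<dots> = (C * r ^ j / sqrt (fact j)) * (sqrt (fact j) * norm (c j))"
    by simp
  also have "\<dots> \<le> 2 * ((C * r ^ j / sqrt (fact j)) * (sqrt (fact j) * norm (c j)))"
    using nonneg by simp
  also have "\<dots> \<le> (C * r ^ j / sqrt (fact j))\<^sup>2 + (sqrt (fact j) * norm (c j))\<^sup>2"
    by (rule two_mult_le_sq)
  also have "\<dots> = C\<^sup>2 * ((r\<^sup>2) ^ j /\<^sub>R fact j) + fact j * (norm (c j))\<^sup>2"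
    by (simp add: power_mult_distrib power_divide power_even_eq divide_inverse power_inverse flip: power_mult)
  finally show "norm (norm (HQ j k q * c j)) \<le> C\<^sup>2 * ((r\<^sup>2) ^ j /\<^sub>R fact j) + fact j * (norm (c j))\<^sup>2" .
qed

lemma HQ_measurable: "HQ m n \<in> borel_measurable borel"
  unfolding HQ_eq_sum[abs_def]
  by (intro borel_measurable_continuous_onI continuous_intros linear_continuous_on bounded_linear_qcnj)

definition hseries :: "nat \<Rightarrow> (nat \<Rightarrow> quat) \<Rightarrow> quat \<Rightarrow> quat"
  where "hseries k c q = (\<Sum>j. HQ j k q * c j)"

text \<open>Since admissible coefficients give convergence at every quaternion, membership in
  \<open>SR2 k\<close> becomes a condition on sequences alone.\<close>

lemma SR2_eq: "SR2 k = hseries k ` {c. summable (\<lambda>j. fact j * (norm (c j))\<^sup>2)}"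
proof (intro subset_antisym subsetI)
  fix F assume "F \<in> SR2 k"
  then obtain c where c: "summable (\<lambda>j. fact j * (norm (c j :: quat))\<^sup>2)"
    and F: "\<And>q. (\<lambda>j. HQ j k q * c j) sums F q" unfolding SR2_def by blast
  have "F = hseries k c" using F by (auto simp: hseries_def sums_iff)
  with c show "F \<in> hseries k ` {c. summable (\<lambda>j. fact j * (norm (c j))\<^sup>2)}" by blast
next
  fix F assume "F \<in> hseries k ` {c. summable (\<lambda>j. fact j * (norm (c j))\<^sup>2)}"
  then obtain c where c: "summable (\<lambda>j. fact j * (norm (c j :: quat))\<^sup>2)" and F: "F = hseries k c"
    by auto
  have "(\<lambda>j. HQ j k q * c j) sums F q" for q
    unfolding F hseries_def by (rule summable_sums[OF summable_HQ_mult[OF c]])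
  with c show "F \<in> SR2 k" unfolding SR2_def by blast
qed

section \<open>The embedded plane and the polynomials spanned by the Hermite polynomials\<close>

definition slice_embed :: "quat \<Rightarrow> complex \<Rightarrow> quat"
  where "slice_embed I z = of_real (Re z) + of_real (Im z) * I"

text \<open>Absorbs the weight of \<open>L2_inner\<close> and \<open>L2_norm\<close>; for an
  imaginary unit the result is finite, as \<open>sqint_complete\<close> requires.\<close>

definition slice_gauss :: "quat \<Rightarrow> quat measure"
  where "slice_gauss I = density (slice_lebesgue I) (\<lambda>q. ennreal (exp (- (norm q)\<^sup>2)))"

text \<open>Finite complex combinations in inductive form, so that orthogonality to the Hermite
  polynomials spreads by rule induction in \<open>cgauss_total\<close>.\<close>

inductive hermite_span :: "(complex \<Rightarrow> complex) \<Rightarrow> bool" where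
  basis: "hermite_span (hermite m n)"
| add: "hermite_span p \<Longrightarrow> hermite_span p' \<Longrightarrow> hermite_span (\<lambda>z. p z + p' z)"
| mult_const: "hermite_span p \<Longrightarrow> hermite_span (\<lambda>z. c * p z)"

text \<open>The recurrences read backwards: multiplying by z or cnj z produces a combination of two
  Hermite polynomials.\<close>

lemma hermite_span_mult:
  assumes "hermite_span p"
  shows "hermite_span (\<lambda>z. z * p z)" and "hermite_span (\<lambda>z. cnj z * p z)"
proof -
  have "hermite_span (\<lambda>z. z * p z) \<and> hermite_span (\<lambda>z. cnj z * p z)"
    using assms
  proof induction
    case (basis m n)
    have "hermite_span (\<lambda>z. hermite (Suc m) n z + of_nat n * hermite m (n - 1) z)"
      "hermite_span (\<lambda>z. hermite m (Suc n) z + of_nat m * hermite (m - 1) n z)"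
      by (rule hermite_span.add[OF hermite_span.basis hermite_span.mult_const[OF hermite_span.basis]])+
    then show ?case by (simp add: hermite_Suc_left hermite_Suc_right)
  next
    case (add p p')
    then show ?case
      using hermite_span.add[of "\<lambda>z. z * p z" "\<lambda>z. z * p' z"]
        hermite_span.add[of "\<lambda>z. cnj z * p z" "\<lambda>z. cnj z * p' z"] by (simp add: distrib_left)
  next
    case (mult_const p c)
    then show ?case
      using hermite_span.mult_const[of "\<lambda>z. z * p z" c] hermite_span.mult_const[of "\<lambda>z. cnj z * p z" c]
      by (simp add: mult.left_commute)
  qed
  then show "hermite_span (\<lambda>z. z * p z)" "hermite_span (\<lambda>z. cnj z * p z)" by auto
qed

text \<open>Re z and Im z are combinations of z and cnj z, with coefficients 1/2, 1/2 and -\<i>/2,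
  \<i>/2, so the powers are built one factor at a time.\<close>

lemma hermite_span_monomial: "hermite_span (\<lambda>z. of_real (Re z ^ a * Im z ^ b))"
proof (induction a)
  case 0
  show ?case
  proof (induction b)
    case 0
    have "hermite 0 0 = (\<lambda>z. 1)" by (simp add: fun_eq_iff)
    then show ?case using hermite_span.basis[of 0 0] by simp
  next
    case (Suc b)
    let ?p = "\<lambda>z. of_real (Re z ^ 0 * Im z ^ b) :: complex"
    have "hermite_span (\<lambda>z. (- \<i> / 2) * (z * ?p z) + (\<i> / 2) * (cnj z * ?p z))"
      by (rule hermite_span.add[OF hermite_span.mult_const[OF hermite_span_mult(1)[OF Suc]]
          hermite_span.mult_const[OF hermite_span_mult(2)[OF Suc]]])
    also have "(\<lambda>z. (- \<i> / 2) * (z * ?p z) + (\<i> / 2) * (cnj z * ?p z)) = (\<lambda>z. of_real (Re z ^ 0 * Im z ^ Suc b))"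
      by (simp add: fun_eq_iff complex_eq_iff)
    finally show ?case .
  qed
next
  case (Suc a)
  let ?p = "\<lambda>z. of_real (Re z ^ a * Im z ^ b) :: complex"
  have "hermite_span (\<lambda>z. (1 / 2) * (z * ?p z) + (1 / 2) * (cnj z * ?p z))"
    by (rule hermite_span.add[OF hermite_span.mult_const[OF hermite_span_mult(1)[OF Suc]]
          hermite_span.mult_const[OF hermite_span_mult(2)[OF Suc]]])
  also have "(\<lambda>z. (1 / 2) * (z * ?p z) + (1 / 2) * (cnj z * ?p z)) = (\<lambda>z. of_real (Re z ^ Suc a * Im z ^ b))"
    by (simp add: fun_eq_iff complex_eq_iff)
  finally show ?case .
qed

text \<open>The moment theorem is applied to f times the weight. Its exponential integrability
  follows from |f| E \<le> f^2 + E^2 with E = exp (t (|x| + |y|)): the weight makes both squares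
  integrable.\<close>

lemma cgauss_moments_eq_0_imp_AE_eq_0:
  fixes f :: "complex \<Rightarrow> real"
  assumes f [measurable]: "f \<in> borel_measurable borel"
    and int: "integrable cgauss (\<lambda>z. (f z)\<^sup>2)"
    and mom: "\<And>a b. (\<integral>z. (Re z ^ a * Im z ^ b) * f z \<partial>cgauss) = 0"
  shows "AE p in lborel. f (Complex (fst p) (snd p)) = 0"
proof -
  define g where "g p = exp (- ((fst p)\<^sup>2 + (snd p)\<^sup>2)) * f (Complex (fst p) (snd p))" for p :: "real \<times> real"
  have [measurable]: "(\<lambda>p::real \<times> real. Complex (fst p) (snd p)) \<in> borel_measurable borel"
    by measurable
  have "AE p in lborel. g p = 0"
  proof (rule moments_eq_0_imp_AE_eq_0_prod)
    show "g \<in> borel_measurable borel" unfolding g_def by measurable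
    show "integrable lborel (\<lambda>(x, y). g (x, y) * exp (t * (\<bar>x\<bar> + \<bar>y\<bar>)))" for t
    proof (rule Bochner_Integration.integrable_bound)
      \<comment> \<open>Completing the square gives 2 t |x| \<le> 2 t^2 + x^2 / 2, so half of the
        Gaussian remains in each variable.\<close>
      let ?B = "exp (2 * t\<^sup>2)"
      have "integrable lborel (\<lambda>(x, y). exp (- (x\<^sup>2 + y\<^sup>2)) * (f (Complex x y))\<^sup>2)"
        using int by (subst (asm) integrable_cgauss_iff) auto
      moreover have "integrable lborel (\<lambda>(x, y). (?B * exp (- (1/2) * x\<^sup>2)) * (?B * exp (- (1/2) * y\<^sup>2)))"
        by (intro integrable_lborel_prod integrable_mult_right integrable_exp_neg_sq) simp_all
      ultimately show "integrable lborel (\<lambda>p. (case p of (x, y) \<Rightarrow> exp (- (x\<^sup>2 + y\<^sup>2)) * (f (Complex x y))\<^sup>2)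
          + (case p of (x, y) \<Rightarrow> (?B * exp (- (1/2) * x\<^sup>2)) * (?B * exp (- (1/2) * y\<^sup>2))))"
        by (rule Bochner_Integration.integrable_add)
      have ex: "exp (2 * (t * \<bar>x\<bar>)) \<le> exp (x\<^sup>2) * (?B * exp (- (1/2) * x\<^sup>2))" for x :: real
      proof -
        have "2 * (t * \<bar>x\<bar>) \<le> x\<^sup>2 + (2 * t\<^sup>2 - (1/2) * x\<^sup>2)"
          using zero_le_power2[of "2 * t - \<bar>x\<bar>"] by (simp add: power2_eq_square algebra_simps)
        then show ?thesis by (simp add: mult_exp_exp)
      qed
      show "AE p in lborel. norm (case p of (x, y) \<Rightarrow> g (x, y) * exp (t * (\<bar>x\<bar> + \<bar>y\<bar>)))
        \<le> norm ((case p of (x, y) \<Rightarrow> exp (- (x\<^sup>2 + y\<^sup>2)) * (f (Complex x y))\<^sup>2)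
          + (case p of (x, y) \<Rightarrow> (?B * exp (- (1/2) * x\<^sup>2)) * (?B * exp (- (1/2) * y\<^sup>2))))"
      proof (rule AE_I2, clarify)
        fix x y :: real
        let ?w = "exp (- (x\<^sup>2 + y\<^sup>2))"
        have "\<bar>f (Complex x y)\<bar> * exp (t * (\<bar>x\<bar> + \<bar>y\<bar>)) \<le> 2 * (\<bar>f (Complex x y)\<bar> * exp (t * (\<bar>x\<bar> + \<bar>y\<bar>)))"
          by simp
        also have "\<dots> \<le> \<bar>f (Complex x y)\<bar>\<^sup>2 + (exp (t * (\<bar>x\<bar> + \<bar>y\<bar>)))\<^sup>2"
          by (rule two_mult_le_sq)
        also have "(exp (t * (\<bar>x\<bar> + \<bar>y\<bar>)))\<^sup>2 = exp (2 * (t * \<bar>x\<bar>)) * exp (2 * (t * \<bar>y\<bar>))"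
          by (simp add: power2_eq_square mult_exp_exp algebra_simps)
        also have "\<dots> \<le> (exp (x\<^sup>2) * (?B * exp (- (1/2) * x\<^sup>2))) * (exp (y\<^sup>2) * (?B * exp (- (1/2) * y\<^sup>2)))"
          by (intro mult_mono ex) auto
        finally have "\<bar>f (Complex x y)\<bar> * exp (t * (\<bar>x\<bar> + \<bar>y\<bar>)) \<le> (f (Complex x y))\<^sup>2 +
            (exp (x\<^sup>2) * (?B * exp (- (1/2) * x\<^sup>2))) * (exp (y\<^sup>2) * (?B * exp (- (1/2) * y\<^sup>2)))"
          by simp
        then have "?w * (\<bar>f (Complex x y)\<bar> * exp (t * (\<bar>x\<bar> + \<bar>y\<bar>))) \<le> ?w * ((f (Complex x y))\<^sup>2 +
            (exp (x\<^sup>2) * (?B * exp (- (1/2) * x\<^sup>2))) * (exp (y\<^sup>2) * (?B * exp (- (1/2) * y\<^sup>2))))"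
          by (intro mult_left_mono) auto
        also have "\<dots> = ?w * (f (Complex x y))\<^sup>2 + (?w * exp (x\<^sup>2) * exp (y\<^sup>2)) * ((?B * exp (- (1/2) * x\<^sup>2)) * (?B * exp (- (1/2) * y\<^sup>2)))"
          by (simp only: distrib_left mult_ac)
        also have "?w * exp (x\<^sup>2) * exp (y\<^sup>2) = 1"
          by (simp add: mult_exp_exp)
        finally have "?w * (\<bar>f (Complex x y)\<bar> * exp (t * (\<bar>x\<bar> + \<bar>y\<bar>))) \<le> \<bar>?w * (f (Complex x y))\<^sup>2
            + (?B * exp (- (1/2) * x\<^sup>2)) * (?B * exp (- (1/2) * y\<^sup>2))\<bar>"
          by simp
        then show "norm (g (x, y) * exp (t * (\<bar>x\<bar> + \<bar>y\<bar>))) \<le> norm (?w * (f (Complex x y))\<^sup>2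
          + (?B * exp (- (1/2) * x\<^sup>2)) * (?B * exp (- (1/2) * y\<^sup>2)))"
          by (simp add: g_def abs_mult mult.assoc)
      qed
    qed (unfold g_def, measurable)
    show "(\<integral>(x, y). g (x, y) * (x ^ a * y ^ b) \<partial>lborel) = 0" for a b
    proof -
      have "(\<integral>z. (Re z ^ a * Im z ^ b) * f z \<partial>cgauss) = (\<integral>(x, y). g (x, y) * (x ^ a * y ^ b) \<partial>lborel)"
        by (subst integral_cgauss) (auto simp: g_def mult_ac intro!: Bochner_Integration.integral_cong)
      with mom[of a b] show ?thesis by simp
    qed
  qed
  then show ?thesis by eventually_elim (simp add: g_def)
qed

section \<open>The decomposition on a slice\<close>

locale imag_unit =
  fixes I :: quat
  assumes I: "I \<in> imag_units"
begin

section \<open>The slice as a copy of the complex plane\<close>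

lemma I_mult_I: "I * I = - 1"
  using I by (simp add: imag_units_def power2_eq_square)

text \<open>A nonzero real part would force the imaginary components to vanish, by the imaginary
  components of \<open>I * I\<close>, leaving a real number with square -1.\<close>

lemma q1_I: "q1 I = 0"
proof (rule ccontr)
  assume "q1 I \<noteq> 0"
  moreover have "2 * q1 I * qi I = 0" "2 * q1 I * qj I = 0" "2 * q1 I * qk I = 0" "q1 (I * I) = - 1"
    using I_mult_I by (simp_all add: quat_eq_iff quat_times_sel)
  ultimately have "(q1 I)\<^sup>2 = - 1" by (simp add: quat_times_sel power2_eq_square)
  then show False using zero_le_power2[of "q1 I"] by linarith
qed

lemma vector_I: "(qi I)\<^sup>2 + (qj I)\<^sup>2 + (qk I)\<^sup>2 = 1"
  using arg_cong[OF I_mult_I, of q1] q1_I by (simp add: quat_times_sel power2_eq_square)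

lemma embed_sel: "q1 (slice_embed I z) = Re z" "qi (slice_embed I z) = Im z * qi I"
    "qj (slice_embed I z) = Im z * qj I" "qk (slice_embed I z) = Im z * qk I"
  by (simp_all add: slice_embed_def quat_times_sel q1_I)

lemma embed_simps:
  "slice_embed I 0 = 0" "slice_embed I 1 = 1" "slice_embed I (z + w) = slice_embed I z + slice_embed I w"
  "slice_embed I (of_real r) = of_real r" "slice_embed I (r *\<^sub>R z) = r *\<^sub>R slice_embed I z"
  "slice_embed I (cnj z) = qcnj (slice_embed I z)"
  by (simp_all add: quat_eq_iff embed_sel algebra_simps)

lemma embed_mult: "slice_embed I (z * w) = slice_embed I z * slice_embed I w"
proof -
  have v: "qi I * qi I = 1 - qj I * qj I - qk I * qk I"
    using vector_I by (simp add: power2_eq_square)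
  have "slice_embed I z * slice_embed I w = of_real (Re z * Re w) + of_real (Re z * Im w + Im z * Re w) * I + of_real (Im z * Im w) * (I * I)"
    by (simp add: slice_embed_def quat_eq_iff quat_times_sel q1_I algebra_simps)
  then show ?thesis
    by (simp add: I_mult_I slice_embed_def algebra_simps)
qed

lemma embed_commute: "slice_embed I z * slice_embed I w = slice_embed I w * slice_embed I z"
  by (metis embed_mult mult.commute)

lemma embed_power: "slice_embed I (z ^ n) = slice_embed I z ^ n"
  by (induction n) (simp_all add: embed_simps embed_mult)

lemma norm_embed: "norm (slice_embed I z) = norm z"
proof -
  have "(norm (slice_embed I z))\<^sup>2 = (Re z)\<^sup>2 + (Im z)\<^sup>2 * ((qi I)\<^sup>2 + (qj I)\<^sup>2 + (qk I)\<^sup>2)"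
    unfolding norm_sq_quat embed_sel by (simp add: power_mult_distrib distrib_left)
  then have "(norm (slice_embed I z))\<^sup>2 = (norm z)\<^sup>2" by (simp add: vector_I cmod_power2)
  then show ?thesis by simp
qed

lemma bounded_linear_embed: "bounded_linear (slice_embed I)"
  by (rule bounded_linear_intro[where K = 1]) (simp_all add: embed_simps norm_embed)

text \<open>The coefficients are real and the embedding respects products and conjugation, so the
  quaternionic polynomial on the slice is the complex one.\<close>

lemma HQ_embed: "HQ m n (slice_embed I z) = slice_embed I (hermite m n z)"
  unfolding HQ_eq_sum hermite_def linear_sum[OF bounded_linear.linear[OF bounded_linear_embed]]
  by (simp only: embed_mult embed_power embed_simps scaleR_conv_of_real)

lemma range_embed: "range (slice_embed I) = slice I"
proof -
  have "(\<exists>z. q = slice_embed I z) \<longleftrightarrow> (\<exists>x y. q = of_real x + of_real y * I)" for q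
    unfolding slice_embed_def by (metis complex.sel)
  then show ?thesis by (auto simp: slice_def image_def)
qed

section \<open>Passing between the slice measure, its completion and \<open>cgauss\<close>\<close>

abbreviation "slice_borel \<equiv> restrict_space (borel :: quat measure) (slice I)"
abbreviation "mu \<equiv> slice_gauss I"

lemma embed_measurable_borel [measurable]: "slice_embed I \<in> borel_measurable borel"
  by (intro borel_measurable_continuous_onI linear_continuous_on bounded_linear_embed)

lemma embed_measurable: "slice_embed I \<in> borel \<rightarrow>\<^sub>M slice_borel"
  by (rule measurable_restrict_space2) (use range_embed in auto)

lemma slice_lebesgue_eq:
  "slice_lebesgue I = completion (distr lborel slice_borel (\<lambda>p. slice_embed I (Complex (fst p) (snd p))))"
  by (simp add: slice_lebesgue_def slice_embed_def case_prod_beta')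

lemma embed_pair_measurable: "(\<lambda>p. slice_embed I (Complex (fst p) (snd p))) \<in> lborel \<rightarrow>\<^sub>M slice_borel"
  by (rule measurable_compose[OF _ embed_measurable]) measurable

lemma slice_borel_imp_mu: "f \<in> borel_measurable slice_borel \<Longrightarrow> f \<in> borel_measurable mu"
  by (simp add: slice_gauss_def slice_lebesgue_eq measurable_completion)

lemma borel_imp_slice_borel: "f \<in> borel_measurable borel \<Longrightarrow> f \<in> borel_measurable slice_borel"
  by (rule measurable_restrict_space1)

lemma borel_measurable_mu_iff: "f \<in> borel_measurable mu \<longleftrightarrow> f \<in> borel_measurable (slice_lebesgue I)"
  by (simp add: slice_gauss_def)

lemma norm_weight_measurable [measurable]: "(\<lambda>q. exp (- (norm q)\<^sup>2)) \<in> borel_measurable (slice_lebesgue I)"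
  unfolding slice_lebesgue_eq
  by (intro measurable_completion, simp, intro borel_imp_slice_borel) measurable

lemma
  fixes f :: "quat \<Rightarrow> 'b::{banach, second_countable_topology}"
  assumes f: "f \<in> borel_measurable (slice_lebesgue I)"
  shows integrable_mu_iff_weighted: "integrable mu f \<longleftrightarrow> integrable (slice_lebesgue I) (\<lambda>q. exp (- (norm q)\<^sup>2) *\<^sub>R f q)"
    and integral_mu_weighted: "integral\<^sup>L mu f = (\<integral>q. exp (- (norm q)\<^sup>2) *\<^sub>R f q \<partial>slice_lebesgue I)"
  unfolding slice_gauss_def using f
  by (simp_all add: integrable_density integral_density)

text \<open>The transfer is stated for Borel functions on the slice, the class for which image
  measures and completion both behave well; other functions pass through
  \<open>ex_borel_representative\<close>.\<close>

lemma
  fixes f :: "quat \<Rightarrow> 'b::{banach, second_countable_topology}"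
  assumes f: "f \<in> borel_measurable slice_borel"
  shows integrable_mu_iff: "integrable mu f \<longleftrightarrow> integrable cgauss (\<lambda>z. f (slice_embed I z))"
    and integral_mu: "integral\<^sup>L mu f = (\<integral>z. f (slice_embed I z) \<partial>cgauss)"
proof -
  let ?D = "distr lborel slice_borel (\<lambda>p. slice_embed I (Complex (fst p) (snd p)))"
  let ?w = "\<lambda>q. exp (- (norm q)\<^sup>2) *\<^sub>R f q"
  have w: "?w \<in> borel_measurable slice_borel"
    by (intro borel_measurable_scaleR f borel_imp_slice_borel) measurable
  have f': "f \<in> borel_measurable (slice_lebesgue I)"
    using slice_borel_imp_mu[OF f] by (simp add: borel_measurable_mu_iff)
  have fe: "(\<lambda>z. f (slice_embed I z)) \<in> borel_measurable borel"
    by (rule measurable_compose[OF embed_measurable f])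
  have norm_eq: "(norm (slice_embed I (Complex x y)))\<^sup>2 = x\<^sup>2 + y\<^sup>2" for x y
    by (simp add: norm_embed cmod_power2)
  have w': "?w \<in> borel_measurable ?D" using w by simp
  show "integrable mu f \<longleftrightarrow> integrable cgauss (\<lambda>z. f (slice_embed I z))"
    unfolding integrable_mu_iff_weighted[OF f'] integrable_cgauss_iff[OF fe] slice_lebesgue_eq
      integrable_completion[OF w'] integrable_distr_eq[OF embed_pair_measurable w] case_prod_beta' norm_eq ..
  show "integral\<^sup>L mu f = (\<integral>z. f (slice_embed I z) \<partial>cgauss)"
    unfolding integral_mu_weighted[OF f'] integral_cgauss[OF fe] slice_lebesgue_eq
      integral_completion[OF w'] integral_distr[OF embed_pair_measurable w] case_prod_beta' norm_eq ..
qed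

lemma AE_mu_iff: "(AE q in mu. P q) \<longleftrightarrow> (AE q in slice_lebesgue I. P q)"
  unfolding slice_gauss_def by (subst AE_density) auto

lemma AE_mu_eq_0_iff:
  fixes f :: "quat \<Rightarrow> quat"
  assumes f: "f \<in> borel_measurable slice_borel"
  shows "(AE q in mu. f q = 0) \<longleftrightarrow> (AE p in lborel. f (slice_embed I (Complex (fst p) (snd p))) = 0)"
proof -
  have "{q \<in> space slice_borel. f q = 0} \<in> sets slice_borel"
    using measurable_sets[OF f, of "{0}"] by (simp add: vimage_def Int_def conj_commute)
  then show ?thesis
    unfolding AE_mu_iff slice_lebesgue_eq AE_completion_iff
    by (intro AE_distr_iff embed_pair_measurable)
qed

lemma finite_measure_mu: "finite_measure mu"
proof
  have "integrable cgauss (\<lambda>z. 1 :: real)"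
    by (rule integrable_cgauss_poly[where B = 1 and n = 0]) simp_all
  then have "integrable mu (\<lambda>q. 1 :: real)"
    by (rule integrable_mu_iff[OF borel_measurable_const, THEN iffD2])
  then show "emeasure mu (space mu) \<noteq> \<infinity>" by (auto simp: integrable_iff_bounded)
qed

section \<open>\<open>L2 I\<close> as \<open>sqint mu\<close>, and the orthogonal family
  \<open>HQ\<close>\<close>

lemma L2_eq: "L2 I = sqint mu"
proof -
  have "integrable mu (\<lambda>q. (norm (f q))\<^sup>2) \<longleftrightarrow> integrable (slice_lebesgue I) (\<lambda>q. (norm (f q))\<^sup>2 * exp (- (norm q)\<^sup>2))"
    if [measurable]: "f \<in> borel_measurable (slice_lebesgue I)" for f :: "quat \<Rightarrow> quat"
    by (subst integrable_mu_iff_weighted) (simp_all add: mult.commute)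
  then show ?thesis by (auto simp: L2_def sqint_def borel_measurable_mu_iff)
qed

lemma L2_inner_eq:
  assumes "f \<in> sqint mu" "g \<in> sqint mu"
  shows "L2_inner I f g = qip mu f g"
proof -
  have [measurable]: "f \<in> borel_measurable (slice_lebesgue I)" "g \<in> borel_measurable (slice_lebesgue I)"
    using assms by (auto simp: sqint_def borel_measurable_mu_iff)
  show ?thesis unfolding L2_inner_def qip_def by (subst integral_mu_weighted) simp_all
qed

lemma L2_norm_eq:
  assumes "f \<in> sqint mu"
  shows "L2_norm I f = sqrt (qn2 mu f)"
proof -
  have [measurable]: "f \<in> borel_measurable (slice_lebesgue I)"
    using assms by (auto simp: sqint_def borel_measurable_mu_iff)
  show ?thesis unfolding L2_norm_def qn2_def
    by (subst integral_mu_weighted) (simp_all add: mult.commute)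
qed

lemma L2_norm_tendsto_iff:
  assumes "\<And>n. u n \<in> sqint mu"
  shows "(\<lambda>n. L2_norm I (u n)) \<longlonglongrightarrow> 0 \<longleftrightarrow> (\<lambda>n. qn2 mu (u n)) \<longlonglongrightarrow> 0"
proof
  assume "(\<lambda>n. L2_norm I (u n)) \<longlonglongrightarrow> 0"
  from tendsto_power[OF this, of 2] show "(\<lambda>n. qn2 mu (u n)) \<longlonglongrightarrow> 0"
    by (simp add: L2_norm_eq assms)
next
  assume "(\<lambda>n. qn2 mu (u n)) \<longlonglongrightarrow> 0"
  from tendsto_real_sqrt[OF this] show "(\<lambda>n. L2_norm I (u n)) \<longlonglongrightarrow> 0"
    by (simp add: L2_norm_eq assms)
qed

lemma hermite_measurable: "hermite m n \<in> borel_measurable borel"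
  unfolding hermite_def[abs_def] by (intro borel_measurable_continuous_onI continuous_intros)

lemma HQ_sqint: "HQ m n \<in> sqint mu"
proof -
  have sq: "(norm (hermite m n z))\<^sup>2 = Re (cnj (hermite m n z) * hermite m n z)" for z
    using complex_norm_square[of "hermite m n z"] by (metis Re_complex_of_real mult.commute)
  have "integrable cgauss (\<lambda>z. (norm (hermite m n z))\<^sup>2)"
    unfolding sq by (intro integrable_Re integrable_hermite_inner)
  moreover have "(\<lambda>q. (norm (HQ m n q))\<^sup>2) \<in> borel_measurable borel"
    using HQ_measurable[of m n] by measurable
  ultimately have "integrable mu (\<lambda>q. (norm (HQ m n q))\<^sup>2)"
    by (subst integrable_mu_iff) (auto simp: HQ_embed norm_embed intro: borel_imp_slice_borel)
  then show ?thesis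
    by (auto simp: sqint_def intro!: slice_borel_imp_mu borel_imp_slice_borel HQ_measurable)
qed

lemma qip_HQ: "qip mu (HQ a b) (HQ m n) = of_real (if a = m \<and> b = n then pi * fact m * fact n else 0)"
proof -
  note [measurable] = HQ_measurable
  have "(\<lambda>q. qcnj (HQ a b q) * HQ m n q) \<in> borel_measurable borel" by measurable
  then have "qip mu (HQ a b) (HQ m n) = (\<integral>z. slice_embed I (cnj (hermite a b z) * hermite m n z) \<partial>cgauss)"
    unfolding qip_def by (subst integral_mu) (auto simp: HQ_embed embed_mult embed_simps intro: borel_imp_slice_borel)
  also have "\<dots> = slice_embed I (\<integral>z. cnj (hermite a b z) * hermite m n z \<partial>cgauss)"
    by (rule integral_bounded_linear[OF bounded_linear_embed integrable_hermite_inner])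
  finally show ?thesis unfolding hermite_inner by (auto simp: embed_simps simp del: of_real_mult)
qed

text \<open>From here on \<open>coef f (j, k)\<close> is the coefficient of f along
  \<open>HQ j k\<close>, where k selects the space \<open>SR2 k\<close>; finiteness of
  \<open>mu\<close> also brings in \<open>sqint_complete\<close>.\<close>

sublocale quat_orthogonal mu "\<lambda>(j, k). HQ j k" "\<lambda>(j, k). pi * fact j * fact k"
proof (intro quat_orthogonal.intro finite_measure_mu quat_orthogonal_axioms.intro)
qed (auto simp: HQ_sqint qip_HQ split: prod.split)

section \<open>Totality of the Hermite polynomials\<close>

lemma cgauss_total:
  assumes F [measurable]: "F \<in> borel_measurable borel" and F_sqint: "F \<in> sqint cgauss"
    and orth: "\<And>m n. qip cgauss (\<lambda>z. slice_embed I (hermite m n z)) F = 0"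
  shows "AE p in lborel. F (Complex (fst p) (snd p)) = 0"
proof -
  have span: "(\<lambda>z. slice_embed I (p z)) \<in> sqint cgauss \<and> qip cgauss (\<lambda>z. slice_embed I (p z)) F = 0"
    if "hermite_span p" for p
    using that
  proof induction
    case (basis m n)
    have "(\<lambda>q. (norm (HQ m n q))\<^sup>2) \<in> borel_measurable slice_borel"
      by (rule borel_imp_slice_borel) (use HQ_measurable[of m n] in measurable)
    then have "integrable cgauss (\<lambda>z. (norm (HQ m n (slice_embed I z)))\<^sup>2)"
      by (rule integrable_mu_iff[THEN iffD1]) (rule sqint_integrable[OF HQ_sqint])
    moreover have "(\<lambda>z. slice_embed I (hermite m n z)) \<in> borel_measurable cgauss"
      using hermite_measurable[of m n] by measurable
    ultimately show ?case by (simp add: sqint_def HQ_embed orth)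
  next
    case (add p p')
    then show ?case by (simp add: embed_simps sqint_add qip_add_left F_sqint)
  next
    \<comment> \<open>Within the slice the constant can be moved to the right of p, where
      \<open>qip_mult_left\<close> extracts it as a left factor of a vanishing inner
      product.\<close>
    case (mult_const p c)
    then show ?case
      by (simp add: embed_mult embed_commute[of c] sqint_mult_right qip_mult_left F_sqint)
  qed
  \<comment> \<open>A real monomial embeds as a real scalar, which a real-linear l lets through.
    Quaternionic orthogonality thus becomes vanishing of the real moments of
    \<open>l (F z)\<close>.\<close>
  have coord: "AE p in lborel. l (F (Complex (fst p) (snd p))) = 0"
    if l: "bounded_linear l" and l_le: "\<And>x. \<bar>l x\<bar> \<le> norm x" for l :: "quat \<Rightarrow> real"
  proof (rule cgauss_moments_eq_0_imp_AE_eq_0)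
    have [measurable]: "l \<in> borel_measurable borel"
      by (intro borel_measurable_continuous_onI linear_continuous_on l)
    show "(\<lambda>z. l (F z)) \<in> borel_measurable borel" by measurable
    show "integrable cgauss (\<lambda>z. (l (F z))\<^sup>2)"
    proof (rule Bochner_Integration.integrable_bound[OF sqint_integrable[OF F_sqint]])
      show "AE z in cgauss. norm ((l (F z))\<^sup>2) \<le> norm ((norm (F z))\<^sup>2)"
        using l_le by (auto simp: abs_le_square_iff[symmetric] intro!: AE_I2)
    qed measurable
    show "(\<integral>z. (Re z ^ a * Im z ^ b) * l (F z) \<partial>cgauss) = 0" for a b
    proof -
      let ?p = "\<lambda>z. complex_of_real (Re z ^ a * Im z ^ b)"
      have p: "(\<lambda>z. slice_embed I (?p z)) \<in> sqint cgauss" "qip cgauss (\<lambda>z. slice_embed I (?p z)) F = 0"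
        using span[OF hermite_span_monomial] by auto
      have "(\<integral>z. l (qcnj (slice_embed I (?p z)) * F z) \<partial>cgauss) = l 0"
        using integral_bounded_linear[OF l qip_integrable[OF p(1) F_sqint]] p(2) by (simp add: qip_def)
      moreover have "l (qcnj (slice_embed I (?p z)) * F z) = (Re z ^ a * Im z ^ b) * l (F z)" for z
        unfolding embed_simps qcnj_simps
        by (simp add: of_real_def linear_cmul[OF bounded_linear.linear[OF l]])
      ultimately show ?thesis
        using linear_0[OF bounded_linear.linear[OF l]] by simp
    qed
  qed
  have sel_le: "\<bar>q1 x\<bar> \<le> norm x" "\<bar>qi x\<bar> \<le> norm x" "\<bar>qj x\<bar> \<le> norm x" "\<bar>qk x\<bar> \<le> norm x" for x
    by (simp_all add: norm_quat_def real_le_rsqrt)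
  show ?thesis
    using coord[OF bounded_linear_q_sel(1) sel_le(1)] coord[OF bounded_linear_q_sel(2) sel_le(2)]
      coord[OF bounded_linear_q_sel(3) sel_le(3)] coord[OF bounded_linear_q_sel(4) sel_le(4)]
    by eventually_elim (simp add: quat_eq_iff)
qed

text \<open>Elements of \<open>L2 I\<close> are measurable only for the completion; a Borel version
  is chosen for each real coordinate and reassembled.\<close>

lemma ex_borel_representative:
  fixes f :: "quat \<Rightarrow> quat"
  assumes "f \<in> borel_measurable mu"
  obtains g where "g \<in> borel_measurable slice_borel" "AE q in mu. f q = g q"
proof -
  let ?D = "distr lborel slice_borel (\<lambda>p. slice_embed I (Complex (fst p) (snd p)))"
  have f [measurable]: "f \<in> borel_measurable (completion ?D)"
    using assms by (simp add: borel_measurable_mu_iff slice_lebesgue_eq)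
  have ex: "\<exists>g\<in>borel_measurable ?D. AE q in ?D. l (f q) = g q"
    if [measurable]: "l \<in> borel_measurable borel" for l :: "quat \<Rightarrow> real"
    by (rule completion_ex_borel_measurable_real) measurable
  have sel: "q1 \<in> borel_measurable borel" "qi \<in> borel_measurable borel"
      "qj \<in> borel_measurable borel" "qk \<in> borel_measurable borel"
    by measurable
  obtain g1 gi gj gk where g: "g1 \<in> borel_measurable ?D" "AE q in ?D. q1 (f q) = g1 q"
      "gi \<in> borel_measurable ?D" "AE q in ?D. qi (f q) = gi q"
      "gj \<in> borel_measurable ?D" "AE q in ?D. qj (f q) = gj q"
      "gk \<in> borel_measurable ?D" "AE q in ?D. qk (f q) = gk q"
    using ex[OF sel(1)] ex[OF sel(2)] ex[OF sel(3)] ex[OF sel(4)] by blast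
  define g where "g q = g1 q *\<^sub>R Quat 1 0 0 0 + gi q *\<^sub>R Quat 0 1 0 0 + gj q *\<^sub>R Quat 0 0 1 0 + gk q *\<^sub>R Quat 0 0 0 1" for q
  have "g \<in> borel_measurable ?D"
    unfolding g_def using g(1,3,5,7) by measurable
  then have "g \<in> borel_measurable slice_borel" by simp
  moreover have "AE q in ?D. f q = g q"
    using g(2,4,6,8) by eventually_elim (simp add: g_def quat_eq_iff)
  then have "AE q in mu. f q = g q"
    unfolding AE_mu_iff slice_lebesgue_eq AE_completion_iff .
  ultimately show ?thesis by (rule that)
qed

lemma mu_total:
  assumes f: "f \<in> sqint mu" and orth: "\<And>m n. qip mu (HQ m n) f = 0"
  shows "AE q in mu. f q = 0"
proof -
  obtain g where g: "g \<in> borel_measurable slice_borel" and fg: "AE q in mu. f q = g q"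
    using ex_borel_representative[OF sqint_measurable[OF f]] .
  have g_mu: "g \<in> borel_measurable mu" by (rule slice_borel_imp_mu[OF g])
  have g_sqint: "g \<in> sqint mu" by (rule sqint_cong_AE[OF f g_mu fg])
  define F where "F z = g (slice_embed I z)" for z
  have F: "F \<in> borel_measurable borel"
    unfolding F_def by (rule measurable_compose[OF embed_measurable g])
  have "integrable cgauss (\<lambda>z. (norm (F z))\<^sup>2)"
    using sqint_integrable[OF g_sqint] unfolding F_def
    by (subst (asm) integrable_mu_iff) (use g in measurable)
  then have F_sqint: "F \<in> sqint cgauss"
    using F by (simp add: sqint_def measurable_cong_sets[OF sets_cgauss refl])
  have "qip cgauss (\<lambda>z. slice_embed I (hermite m n z)) F = 0" for m n
  proof -
    have [measurable]: "HQ m n \<in> borel_measurable slice_borel"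
      by (intro borel_imp_slice_borel HQ_measurable)
    have "qip mu (HQ m n) g = qip mu (HQ m n) f"
      by (rule qip_cong_AE) (use g_mu f HQ_sqint fg in \<open>auto simp: sqint_def\<close>)
    then have "qip mu (HQ m n) g = 0" by (simp add: orth)
    then show ?thesis
      unfolding qip_def F_def using g by (subst (asm) integral_mu) (auto simp: HQ_embed)
  qed
  from cgauss_total[OF F F_sqint this] have "AE q in mu. g q = 0"
    unfolding AE_mu_eq_0_iff[OF g] F_def .
  with fg show ?thesis by eventually_elim simp
qed

section \<open>Elements of \<open>SR2 k\<close> as orthogonal series on the slice\<close>

lemma hseries_series:
  assumes "summable (\<lambda>j. fact j * (norm (c j))\<^sup>2)"
  shows "quat_orthogonal_series mu (\<lambda>(j, k). HQ j k) (\<lambda>(j, k). pi * fact j * fact k)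
    (\<lambda>j. (j, k)) (\<lambda>(j, l). c j) (hseries k c)"
proof unfold_locales
  have "summable (\<lambda>j. (pi * fact k) * (fact j * (norm (c j))\<^sup>2))"
    by (rule summable_mult[OF assms])
  then show "summable (\<lambda>j. (case (j, k) of (j, k) \<Rightarrow> pi * fact j * fact k) * (norm (case (j, k) of (j, l) \<Rightarrow> c j))\<^sup>2)"
    by (simp add: mult_ac)
  show "(\<lambda>j. (case (j, k) of (j, k) \<Rightarrow> HQ j k) q * (case (j, k) of (j, l) \<Rightarrow> c j)) sums hseries k c q" for q
    using summable_sums[OF summable_HQ_mult[OF assms]] by (simp add: hseries_def)
qed (simp add: inj_def)

lemma
  assumes c: "summable (\<lambda>j. fact j * (norm (c j))\<^sup>2)"
  shows hseries_sqint: "hseries k c \<in> sqint mu"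
    and coef_hseries: "coef (hseries k c) (j, l) = (if l = k then c j else 0)"
    and qn2_hseries_le: "qn2 mu (hseries k c) \<le> (\<Sum>j. pi * fact j * fact k * (norm (c j))\<^sup>2)"
    and qip_hseries_eq_0: "g \<in> sqint mu \<Longrightarrow> (\<And>j. qip mu (HQ j k) g = 0) \<Longrightarrow> qip mu g (hseries k c) = 0"
proof -
  interpret S: quat_orthogonal_series mu "\<lambda>(j, k). HQ j k" "\<lambda>(j, k). pi * fact j * fact k"
    "\<lambda>j. (j, k)" "\<lambda>(j, l). c j" "hseries k c"
    by (rule hseries_series[OF c])
  show "hseries k c \<in> sqint mu" by (rule S.F_sqint)
  show "coef (hseries k c) (j, l) = (if l = k then c j else 0)"
    using S.coef_F[of "(j, l)"] by auto
  show "qn2 mu (hseries k c) \<le> (\<Sum>j. pi * fact j * fact k * (norm (c j))\<^sup>2)"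
    using S.qn2_F_le by simp
  show "qip mu g (hseries k c) = 0" if "g \<in> sqint mu" "\<And>j. qip mu (HQ j k) g = 0"
    using S.qip_F_eq_0 that by simp
qed

text \<open>Bessel on finite pieces of the k-th column. The third claim is the admissibility
  condition of \<open>SR2 k\<close>, so \<open>hseries k\<close> of this column is available as the
  projection of f.\<close>

lemma summable_coef:
  assumes "f \<in> sqint mu"
  shows "summable (\<lambda>j. pi * fact j * fact k * (norm (coef f (j, k)))\<^sup>2)"
    and "(\<Sum>j. pi * fact j * fact k * (norm (coef f (j, k)))\<^sup>2) \<le> qn2 mu f"
    and "summable (\<lambda>j. fact j * (norm (coef f (j, k)))\<^sup>2)"
proof -
  have le: "(\<Sum>j<n. pi * fact j * fact k * (norm (coef f (j, k)))\<^sup>2) \<le> qn2 mu f" for n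
  proof -
    have "(\<Sum>j<n. pi * fact j * fact k * (norm (coef f (j, k)))\<^sup>2)
        = (\<Sum>i\<in>(\<lambda>j. (j, k)) ` {..<n}. (case i of (j, k) \<Rightarrow> pi * fact j * fact k) * (norm (coef f i))\<^sup>2)"
      by (subst sum.reindex) (auto simp: inj_on_def)
    also have "\<dots> \<le> qn2 mu f"
      by (rule Bessel) (simp_all add: assms)
    finally show ?thesis .
  qed
  show 1: "summable (\<lambda>j. pi * fact j * fact k * (norm (coef f (j, k)))\<^sup>2)"
    by (rule summableI_nonneg_bounded[OF _ le]) simp
  show "(\<Sum>j. pi * fact j * fact k * (norm (coef f (j, k)))\<^sup>2) \<le> qn2 mu f"
    by (rule suminf_le_const[OF 1 le])
  have "summable (\<lambda>j. inverse (pi * fact k) * (pi * fact j * fact k * (norm (coef f (j, k)))\<^sup>2))"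
    by (rule summable_mult[OF 1])
  then show "summable (\<lambda>j. fact j * (norm (coef f (j, k)))\<^sup>2)"
    by (simp add: field_simps)
qed

lemma hseries_diff:
  assumes "summable (\<lambda>j. fact j * (norm (c j))\<^sup>2)" "summable (\<lambda>j. fact j * (norm (d j))\<^sup>2)"
  shows "hseries k c q - hseries k d q = hseries k (\<lambda>j. c j - d j) q"
  unfolding hseries_def
  by (subst suminf_diff) (simp_all add: summable_HQ_mult assms right_diff_distrib)

text \<open>Integrals over a single slice recover the coefficients, and with them the function at
  every quaternion.\<close>

lemma SR2_coef:
  assumes "F \<in> SR2 k"
  shows "F \<in> sqint mu" "F = hseries k (\<lambda>j. coef F (j, k))" "summable (\<lambda>j. fact j * (norm (coef F (j, k)))\<^sup>2)"
proof -
  obtain c where c: "summable (\<lambda>j. fact j * (norm (c j))\<^sup>2)" and F: "F = hseries k c"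
    using assms unfolding SR2_eq by auto
  show F_sqint: "F \<in> sqint mu" unfolding F by (rule hseries_sqint[OF c])
  show "F = hseries k (\<lambda>j. coef F (j, k))"
    unfolding F coef_hseries[OF c] by simp
  show "summable (\<lambda>j. fact j * (norm (coef F (j, k)))\<^sup>2)"
    by (rule summable_coef(3)[OF F_sqint])
qed

text \<open>This legitimises identifying a function on all quaternions with its restriction to the
  slice.\<close>

lemma SR2_eq_of_AE_eq:
  assumes "F \<in> SR2 k" "G \<in> SR2 k" "AE q in slice_lebesgue I. F q = G q"
  shows "F = G"
proof -
  have "coef F i = coef G i" for i
    unfolding coef_def
    by (subst qip_cong_AE[where g = G])
      (use assms SR2_coef(1)[OF assms(1)] SR2_coef(1)[OF assms(2)] in
        \<open>auto simp: sqint_def AE_mu_iff HQ_sqint[THEN sqint_measurable] split: prod.split\<close>)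
  then show ?thesis
    using SR2_coef(2)[OF assms(1)] SR2_coef(2)[OF assms(2)] by simp
qed

lemma SR2_orthogonal:
  assumes "k \<noteq> l" "F \<in> SR2 k" "G \<in> SR2 l"
  shows "qip mu F G = 0"
proof -
  obtain c where c: "summable (\<lambda>j. fact j * (norm (c j))\<^sup>2)" and F: "F = hseries k c"
    using assms unfolding SR2_eq by auto
  have "coef F (j, l) = 0" for j
    unfolding F coef_hseries[OF c] using assms by simp
  then have "qip mu (HQ j l) F = 0" for j
    using qip_e_coef[of "(j, l)" F] by simp
  then show ?thesis
    using qip_hseries_eq_0[OF SR2_coef(3)[OF assms(3)] SR2_coef(1)[OF assms(2)]] SR2_coef(2)[OF assms(3)]
    by metis
qed

text \<open>The witness g is the projection of f onto \<open>SR2 k\<close>. Since u n - g is the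
  projection of u n - f, it is no larger, and comparing f with g through u n costs a factor 2 + 2 =
  4.\<close>

lemma SR2_closed:
  assumes u: "\<And>n. u n \<in> SR2 k" and f: "f \<in> sqint mu"
    and lim: "(\<lambda>n. qn2 mu (\<lambda>q. u n q - f q)) \<longlonglongrightarrow> 0"
  shows "\<exists>g\<in>SR2 k. AE q in mu. f q = g q"
proof
  define d where "d j = coef f (j, k)" for j
  have d: "summable (\<lambda>j. fact j * (norm (d j))\<^sup>2)"
    unfolding d_def by (rule summable_coef(3)[OF f])
  define g where "g = hseries k d"
  show "g \<in> SR2 k" unfolding g_def SR2_eq using d by auto
  have g: "g \<in> sqint mu" unfolding g_def by (rule hseries_sqint[OF d])
  have un: "u n \<in> sqint mu" for n by (rule SR2_coef(1)[OF u])
  have ug: "qn2 mu (\<lambda>q. u n q - g q) \<le> qn2 mu (\<lambda>q. u n q - f q)" for n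
  proof -
    have uf: "(\<lambda>q. u n q - f q) \<in> sqint mu" by (rule sqint_diff[OF un f])
    have cd: "coef (\<lambda>q. u n q - f q) (j, k) = coef (u n) (j, k) - d j" for j
      by (simp add: coef_diff un f d_def)
    have eq: "(\<lambda>q. u n q - g q) = hseries k (\<lambda>j. coef (u n) (j, k) - d j)"
      unfolding g_def hseries_diff[OF SR2_coef(3)[OF u] d, symmetric]
      using SR2_coef(2)[OF u, of n] by metis
    have "qn2 mu (\<lambda>q. u n q - g q) \<le> (\<Sum>j. pi * fact j * fact k * (norm (coef (u n) (j, k) - d j))\<^sup>2)"
      using summable_coef(3)[OF uf, of k] unfolding cd eq by (rule qn2_hseries_le)
    also have "\<dots> \<le> qn2 mu (\<lambda>q. u n q - f q)"
      using summable_coef(2)[OF uf, of k] unfolding cd .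
    finally show ?thesis .
  qed
  have le: "qn2 mu (\<lambda>q. f q - g q) \<le> 4 * qn2 mu (\<lambda>q. u n q - f q)" for n
  proof -
    have "qn2 mu (\<lambda>q. (f q - u n q) + (u n q - g q)) \<le> 2 * qn2 mu (\<lambda>q. f q - u n q) + 2 * qn2 mu (\<lambda>q. u n q - g q)"
      by (rule qn2_add_le) (intro sqint_diff f un g)+
    then show ?thesis using ug[of n] qn2_minus[of mu f "u n"] by simp
  qed
  have "(\<lambda>n. 4 * qn2 mu (\<lambda>q. u n q - f q)) \<longlonglongrightarrow> 0"
    using tendsto_mult_right_zero[OF lim] .
  then have "qn2 mu (\<lambda>q. f q - g q) \<le> 0"
    by (rule LIMSEQ_le_const) (use le in blast)
  then have "qn2 mu (\<lambda>q. f q - g q) = 0"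
    by (simp add: order_antisym)
  then have "AE q in mu. f q - g q = 0"
    using qn2_eq_0_iff[OF sqint_diff[OF f g]] by simp
  then show "AE q in mu. f q = g q" by simp
qed

lemma SR2_closed_right_subspace: "closed_right_subspace I (SR2 k)"
proof -
  have zero: "(\<lambda>q. 0) \<in> SR2 k"
    unfolding SR2_eq by (rule image_eqI[of _ _ "\<lambda>j. 0"]) (simp_all add: hseries_def fun_eq_iff)
  have add: "(\<lambda>q. F q + G q) \<in> SR2 k" if "F \<in> SR2 k" "G \<in> SR2 k" for F G
  proof -
    obtain c d where c: "summable (\<lambda>j. fact j * (norm (c j))\<^sup>2)" and F: "F = hseries k c"
      and d: "summable (\<lambda>j. fact j * (norm (d j))\<^sup>2)" and G: "G = hseries k d"
      using \<open>F \<in> SR2 k\<close> \<open>G \<in> SR2 k\<close> unfolding SR2_eq by auto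
    have "summable (\<lambda>j. fact j * (norm (c j + d j))\<^sup>2)"
    proof (rule summable_comparison_test')
      show "summable (\<lambda>j. 2 * (fact j * (norm (c j))\<^sup>2) + 2 * (fact j * (norm (d j))\<^sup>2))"
        by (intro summable_add summable_mult c d)
      fix j
      have "fact j * (norm (c j + d j))\<^sup>2 \<le> fact j * (2 * (norm (c j))\<^sup>2 + 2 * (norm (d j))\<^sup>2)"
        by (intro mult_left_mono norm_add_sq_le) simp
      then show "norm (fact j * (norm (c j + d j))\<^sup>2) \<le> 2 * (fact j * (norm (c j))\<^sup>2) + 2 * (fact j * (norm (d j))\<^sup>2)"
        by (simp add: algebra_simps)
    qed
    moreover have "(\<lambda>q. F q + G q) = hseries k (\<lambda>j. c j + d j)"
      unfolding F G hseries_def distrib_left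
      by (subst suminf_add) (simp_all add: summable_HQ_mult c d)
    ultimately show ?thesis unfolding SR2_eq by blast
  qed
  have mult: "(\<lambda>q. F q * a) \<in> SR2 k" if "F \<in> SR2 k" for F a
  proof -
    obtain c where c: "summable (\<lambda>j. fact j * (norm (c j))\<^sup>2)" and F: "F = hseries k c"
      using \<open>F \<in> SR2 k\<close> unfolding SR2_eq by auto
    have "summable (\<lambda>j. fact j * (norm (c j * a))\<^sup>2)"
      using summable_mult2[OF c, of "(norm a)\<^sup>2"] by (simp add: norm_mult_quat power_mult_distrib mult.assoc)
    moreover have "(\<lambda>q. F q * a) = hseries k (\<lambda>j. c j * a)"
      unfolding F hseries_def mult.assoc[symmetric]
      by (subst suminf_mult2) (simp_all add: summable_HQ_mult c)
    ultimately show ?thesis unfolding SR2_eq by blast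
  qed
  have closed: "\<exists>g\<in>SR2 k. AE q in slice_lebesgue I. f q = g q"
    if "\<forall>n. u n \<in> SR2 k" "f \<in> L2 I" "(\<lambda>n. L2_norm I (\<lambda>q. u n q - f q)) \<longlonglongrightarrow> 0" for u f
  proof -
    have f: "f \<in> sqint mu" using that(2) by (simp add: L2_eq)
    have "(\<lambda>q. u n q - f q) \<in> sqint mu" for n
      by (rule sqint_diff[OF SR2_coef(1)[OF spec[OF that(1)]] f])
    then have "(\<lambda>n. qn2 mu (\<lambda>q. u n q - f q)) \<longlonglongrightarrow> 0"
      using that(3) L2_norm_tendsto_iff[of "\<lambda>n q. u n q - f q"] by simp
    then show ?thesis
      using SR2_closed[of u k f] that(1) f by (simp add: AE_mu_iff)
  qed
  show ?thesis
    unfolding closed_right_subspace_def using zero add mult closed SR2_coef(1) by (auto simp: L2_eq)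
qed

text \<open>One inclusion is built into \<open>hilbert_sum\<close>. For the other, the projections
  of f onto the \<open>SR2 k\<close> are summed; the limit shares all coefficients with f, so
  totality identifies the two.\<close>

lemma hilbert_sum_SR2: "hilbert_sum I SR2 = L2 I"
proof (intro subset_antisym subsetI)
  fix f assume "f \<in> L2 I"
  then have f: "f \<in> sqint mu" by (simp add: L2_eq)
  define c where "c k j = coef f (j, k)" for k j
  have c: "summable (\<lambda>j. fact j * (norm (c k j))\<^sup>2)" for k
    unfolding c_def by (rule summable_coef(3)[OF f])
  define u where "u k = hseries k (c k)" for k
  have u_SR2: "u k \<in> SR2 k" for k unfolding u_def SR2_eq using c by auto
  have u: "u k \<in> sqint mu" for k by (rule SR2_coef(1)[OF u_SR2])
  have u_orth: "qip mu (u k) (u l) = 0" if "k \<noteq> l" for k l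
    by (rule SR2_orthogonal[OF that u_SR2 u_SR2])
  define a where "a k = (\<Sum>j. pi * fact j * fact k * (norm (c k j))\<^sup>2)" for k
  have qn2_u: "qn2 mu (u k) \<le> a k" for k
    unfolding u_def a_def by (rule qn2_hseries_le[OF c])
  \<comment> \<open>Each a k is already an infinite sum, so Bessel is used on finite rectangles of
    indices (j, k), and only then J tends to infinity.\<close>
  have a_sum: "(\<Sum>k<n. a k) \<le> qn2 mu f" for n
  proof (rule LIMSEQ_le_const2)
    show "(\<lambda>J. \<Sum>k<n. \<Sum>j<J. pi * fact j * fact k * (norm (c k j))\<^sup>2) \<longlonglongrightarrow> (\<Sum>k<n. a k)"
      unfolding a_def c_def by (intro tendsto_sum summable_LIMSEQ summable_coef(1)[OF f])
    have "(\<Sum>k<n. \<Sum>j<J. pi * fact j * fact k * (norm (c k j))\<^sup>2) \<le> qn2 mu f" for J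
    proof -
      have "(\<Sum>k<n. \<Sum>j<J. pi * fact j * fact k * (norm (c k j))\<^sup>2)
          = (\<Sum>j<J. \<Sum>k<n. pi * fact j * fact k * (norm (c k j))\<^sup>2)"
        by (rule sum.swap)
      also have "\<dots> = (\<Sum>i\<in>{..<J} \<times> {..<n}. (case i of (j, k) \<Rightarrow> pi * fact j * fact k) * (norm (coef f i))\<^sup>2)"
        by (simp add: sum.cartesian_product c_def case_prod_beta')
      also have "\<dots> \<le> qn2 mu f" by (rule Bessel) (simp_all add: f)
      finally show ?thesis .
    qed
    then show "\<exists>N. \<forall>J\<ge>N. (\<Sum>k<n. \<Sum>j<J. pi * fact j * fact k * (norm (c k j))\<^sup>2) \<le> qn2 mu f"
      by blast
  qed
  have a_nonneg: "0 \<le> a k" for k using qn2_u[of k] qn2_nonneg[of mu "u k"] by linarith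
  have a_summable: "summable a"
    by (rule summableI_nonneg_bounded[OF a_nonneg a_sum])
  define S where "S n q = (\<Sum>k<n. u k q)" for n q
  have S: "S n \<in> sqint mu" for n
    unfolding S_def[abs_def] by (intro sqint_sum u)
  have S_diff: "qn2 mu (\<lambda>q. S n q - S m q) \<le> (\<Sum>k\<in>{m..<n}. a k)" if "m \<le> n" for m n
  proof -
    have eq: "(\<lambda>q. S n q - S m q) = (\<lambda>q. \<Sum>k\<in>{m..<n}. u k q)"
      unfolding S_def using that by (simp add: sum_diff[symmetric] lessThan_minus_lessThan)
    have "qn2 mu (\<lambda>q. S n q - S m q) = (\<Sum>k\<in>{m..<n}. qn2 mu (u k))"
      unfolding eq by (rule qn2_sum_orthogonal) (simp_all add: u u_orth)
    also have "\<dots> \<le> (\<Sum>k\<in>{m..<n}. a k)" by (intro sum_mono qn2_u)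
    finally show ?thesis .
  qed
  obtain g where g: "g \<in> sqint mu" and lim: "(\<lambda>n. qn2 mu (\<lambda>q. g q - S n q)) \<longlonglongrightarrow> 0"
  proof (rule sqint_complete[of S, OF S])
    fix r :: real assume "r > 0"
    then obtain N where N: "\<And>m n. m \<ge> N \<Longrightarrow> norm (\<Sum>k\<in>{m..<n}. a k) < r"
      using a_summable unfolding summable_Cauchy by blast
    have "qn2 mu (\<lambda>q. S m q - S n q) \<le> r" if "m \<ge> N" "n \<ge> N" for m n
    proof (cases "m \<le> n")
      case True
      then show ?thesis using S_diff[OF True] N[of m n] that qn2_minus[of mu "S m" "S n"] by simp
    next
      case False
      then show ?thesis using S_diff[of n m] N[of n m] that by simp
    qed
    then show "\<exists>N. \<forall>m\<ge>N. \<forall>n\<ge>N. qn2 mu (\<lambda>q. S m q - S n q) \<le> r" by blast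
  qed
  have "qip mu (HQ j k) (\<lambda>q. f q - g q) = 0" for j k
  proof -
    have "(\<lambda>n. qip mu (HQ j k) (S n)) \<longlonglongrightarrow> qip mu (HQ j k) g"
      by (rule qip_tendsto[OF HQ_sqint g S lim])
    \<comment> \<open>Only the summand u k meets \<open>HQ j k\<close>, so the pairing is constant
      as soon as n exceeds k.\<close>
    moreover have "qip mu (HQ j k) (S n) = qip mu (HQ j k) f" if "n > k" for n
    proof -
      have "qip mu (HQ j k) (S n) = (\<Sum>l<n. qip mu (HQ j k) (u l))"
        unfolding S_def[abs_def] by (intro qip_sum_right HQ_sqint u)
      also have "\<dots> = (\<Sum>l<n. if l = k then qip mu (HQ j k) f else 0)"
      proof (intro sum.cong refl)
        fix l
        have "coef (u l) (j, k) = (if k = l then coef f (j, k) else 0)"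
          unfolding u_def coef_hseries[OF c] by (simp add: c_def)
        then show "qip mu (HQ j k) (u l) = (if l = k then qip mu (HQ j k) f else 0)"
          using qip_e_coef[of "(j, k)" "u l"] qip_e_coef[of "(j, k)" f] by simp
      qed
      also have "\<dots> = qip mu (HQ j k) f" using that by simp
      finally show ?thesis .
    qed
    then have "(\<lambda>n. qip mu (HQ j k) (S n)) \<longlonglongrightarrow> qip mu (HQ j k) f"
      by (intro tendsto_eventually eventually_mono[OF eventually_gt_at_top[of k]])
    ultimately have "qip mu (HQ j k) g = qip mu (HQ j k) f"
      by (rule LIMSEQ_unique)
    then show ?thesis by (simp add: qip_diff_right HQ_sqint f g)
  qed
  then have "AE q in mu. f q - g q = 0"
    by (rule mu_total[OF sqint_diff[OF f g]])
  then have "qn2 mu (\<lambda>q. f q - S n q) = qn2 mu (\<lambda>q. g q - S n q)" for n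
    using f g S[of n] by (intro qn2_cong_AE borel_measurable_diff sqint_measurable) auto
  then have "(\<lambda>n. L2_norm I (\<lambda>q. f q - S n q)) \<longlonglongrightarrow> 0"
    using lim by (subst L2_norm_tendsto_iff) (simp_all add: sqint_diff f S)
  with f u_SR2 show "f \<in> hilbert_sum I SR2"
    unfolding hilbert_sum_def S_def by (auto simp: L2_eq)
qed (simp add: hilbert_sum_def)

end

theorem theorem3p10:
  fixes I :: quat
  assumes "I \<in> imag_units"
  shows "(\<forall>k. \<forall>F\<in>SR2 k. \<forall>G\<in>SR2 k. (AE q in slice_lebesgue I. F q = G q) \<longrightarrow> F = G)
    \<and> orthogonal_hilbert_decomposition I (L2 I) SR2"
proof -
  interpret imag_unit I by standard (rule assms)
  have "L2_inner I F G = 0" if "k \<noteq> l" "F \<in> SR2 k" "G \<in> SR2 l" for k l F G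
    using that by (simp add: L2_inner_eq SR2_coef(1) SR2_orthogonal)
  then show ?thesis
    unfolding orthogonal_hilbert_decomposition_def hilbert_sum_SR2
    using SR2_eq_of_AE_eq SR2_closed_right_subspace by blast
qed

end
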